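(* We have $$\sum_{n\le x}A(n,N)\sim\frac1{N!}\,\frac{x^N}{\log x},\qquad x\to+\infty,\quad\text{for each fixed }N\ge2,$$ $$A(n,N)\sim\frac1{(N-1)!}\,\frac{n^{N-1}}{\log n},\qquad n\to\infty,\quad\text{for each fixed }N\ge3.$$
   Context: For $m\ge2$, $p_1(m)$ is the smallest prime divisor of $m$. For $2\le N\le n$, $A(n,N)$ (a Cyrillic "el" in the paper) is the number of compositions $(\lambda_1,\dots,\lambda_N)\in\mathbb Z_{>0}^N$ with $\lambda_1+\dots+\lambda_N=n$ and $\min\{\lambda_1,\lambda_2\}<p_1(\lambda_1+\lambda_2)$; it is the number of partial flag varieties $F_{\boldsymbol\lambda}$ of $N$-step flags in $\mathbb C^n$ whose first semiclassical spectrum is not exceeding (one gets the same number using $(\lambda_i,\lambda_{i+1})$ for any fixed $i\le N-1$). $A(n,N)=0$ for $n<N$. *)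

theory Defs
  imports
    Complex_Main
    "HOL-Computational_Algebra.Primes"
    "HOL-Library.Landau_Symbols"
begin

(* Meaningful for m >= 2 only; it is applied below to sums of two positive integers. *)
definition smallest_prime_divisor :: "nat \<Rightarrow> nat" where
  "smallest_prime_divisor m = (LEAST p. prime p \<and> p dvd m)"

definition compositions :: "nat \<Rightarrow> nat \<Rightarrow> nat list set" where
  "compositions n N = {l. length l = N \<and> (\<forall>k \<in> set l. 0 < k) \<and> sum_list l = n}"

(* The pair (lambda_1, lambda_2) of the source is (l ! 0, l ! 1), so N >= 2 is required.
   For n < N there are no compositions and the count is 0, which is the stated convention. *)
definition non_exceeding_count :: "nat \<Rightarrow> nat \<Rightarrow> nat" where
  "non_exceeding_count n N =
     card {l \<in> compositions n N. min (l ! 0) (l ! 1) < smallest_prime_divisor (l ! 0 + l ! 1)}"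

end

theory Submission
  imports Defs "HOL-Complex_Analysis.Complex_Analysis" "HOL-Number_Theory.Prime_Powers" "HOL-Real_Asymp.Real_Asymp"
begin

text \<open>
  Write \<open>A n N\<close> for the number counted by \<^const>\<open>non_exceeding_count\<close>.

  For a two-part composition of a prime \<open>n\<close> the condition always holds, so \<open>A n 2 = n - 1\<close>.
  For composite \<open>n\<close> the least prime divisor is at most \<open>\<surd>n\<close>, so one of the two parts is below
  \<open>\<surd>n\<close> and \<open>A n 2 \<le> 2\<surd>n\<close>.  Hence the sum of \<open>A n 2\<close> over \<open>n \<le> x\<close> is, up to lower order, the sum of
  the primes up to \<open>x\<close>.  That this is asymptotic to \<open>x\<^sup>2 / (2 ln x)\<close> is the
  prime number theorem in another guise, which carries the analytic content.  Deleting the last part of a composition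
  gives \<open>A n (N + 1) = (\<Sum>m<n. A m N)\<close> for \<open>N \<ge> 2\<close>, so the pointwise asymptotics for \<open>N + 1\<close> are the summatory
  asymptotics for \<open>N\<close>, and summing once more yields the summatory asymptotics for \<open>N + 1\<close>.

  The prime number theorem is obtained by Newman's method in the form \<open>\<psi>(n) \<sim> n\<close>.
  \<^item> The Tauberian theorem \<open>newman_tauberian\<close> turns the holomorphic continuation of a
    Dirichlet series to the closed half-plane \<open>Re z \<ge> 0\<close> into its convergence at \<open>0\<close>.
  \<^item> \<open>h(s) = (s - 1) \<zeta>(s)\<close> is holomorphic for \<open>Re s > 0\<close>, and \<open>h\<close> has no zero with \<open>Re s \<ge> 1\<close>
    (\<open>zeta_regularized_nonzero\<close>), by the inequality \<open>3 + 4 cos t + cos 2t \<ge> 0\<close> applied to the series of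
    the von Mangoldt function, which is \<open>- \<zeta>'/\<zeta>\<close>.
  \<^item> Chebyshev's bound \<open>\<psi>(n) \<le> 4n\<close> makes \<open>(\<psi>(k) - k)/k\<close> bounded, and a summation by parts
    expresses the series with terms \<open>(\<psi>(k) - k) k\<^bsup>-2-z\<^esup>\<close> through \<open>- \<zeta>'/\<zeta> - \<zeta>\<close>, in which the poles
    at \<open>1\<close> cancel.  So Newman's theorem shows that the sum of \<open>(\<psi>(k) - k)/k\<^sup>2\<close> converges.
  \<^item> As \<open>\<psi>\<close> is increasing, a deviation of \<open>\<psi>(n)/n\<close> from \<open>1\<close> would persist over an interval
    of length proportional to \<open>n\<close> and contradict that convergence.

  Finally the logarithms are handled by weighting:  \<open>A n 2 \<cdot> ln n\<close> differs from \<open>n \<Lambda>(n)\<close> by an amount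
  that is negligible on average, and \<open>sum_without_log\<close> removes the weight \<open>ln n\<close> again.
\<close>

section \<open>Newman's Tauberian theorem\<close>

lemma has_contour_integral_inverse_arc:
  assumes "a < b" "r > 0"
  shows "((\<lambda>z. 1 / z) has_contour_integral (\<i> * of_real (b - a))) (part_circlepath 0 r a b)"
proof -
  have "((\<lambda>t. \<i>) has_integral (b - a) *\<^sub>R \<i>) {a..b}"
    using has_integral_const_real[of "\<i>" a b] assms by simp
  moreover have "1 / (0 + of_real r * cis t) * of_real r * \<i> * cis t = \<i>" for t
    using assms by (simp add: field_simps)
  ultimately have "((\<lambda>t. 1 / (0 + of_real r * cis t) * of_real r * \<i> * cis t) has_integral (b - a) *\<^sub>R \<i>) {a..b}"
    by (simp only:)
  then show ?thesis
    using assms(1) by (simp add: has_contour_integral_part_circlepath_iff scaleR_conv_of_real mult.commute)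
qed

text \<open>
  \<open>Ln (- z)\<close> is a primitive of \<open>1 / z\<close> on the closed left half-plane without \<open>0\<close>, so the integral
  depends only on the end points.  It yields the winding number of the closed paths below.
\<close>
lemma has_contour_integral_inverse_left:
  assumes R: "R > 0" and \<gamma>: "valid_path \<gamma>" "path_image \<gamma> \<subseteq> {z. Re z \<le> 0} - {0}"
    and ends: "pathstart \<gamma> = \<i> * of_real R" "pathfinish \<gamma> = - (\<i> * of_real R)"
  shows "((\<lambda>z. 1 / z) has_contour_integral (\<i> * of_real pi)) \<gamma>"
proof -
  have "((\<lambda>z. Ln (- z)) has_field_derivative 1 / z) (at z within {z. Re z \<le> 0} - {0})"
    if "z \<in> {z. Re z \<le> 0} - {0}" for z
  proof -
    have "- z \<notin> \<real>\<^sub>\<le>\<^sub>0"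
      using that by (auto simp: complex_nonpos_Reals_iff complex_eq_iff)
    then show ?thesis
      by (auto intro!: derivative_eq_intros simp: field_simps)
  qed
  from contour_integral_primitive[OF this \<gamma>]
  have "((\<lambda>z. 1 / z) has_contour_integral (Ln (\<i> * of_real R) - Ln (- (\<i> * of_real R)))) \<gamma>"
    by (simp add: ends)
  moreover have "Ln (\<i> * of_real R) = ln R + \<i> * of_real (pi / 2)"
    using R Ln_times_of_real[of R \<i>] by (simp add: mult.commute Ln_of_real)
  moreover have "Ln (- (\<i> * of_real R)) = ln R - \<i> * of_real (pi / 2)"
    using R Ln_times_of_real[of R "-\<i>"] by (simp add: mult.commute Ln_of_real)
  ultimately show ?thesis
    by (simp add: field_simps)
qed

text \<open>
  Cauchy's formula at \<open>0\<close> for the right half circle closed up by any path in the left half-plane.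
  The path is arbitrary because Newman's argument uses two of them: a half circle for the partial
  sums, which are entire, and a path close to the imaginary axis for the limit function, which is only
  known to be holomorphic slightly beyond that axis.
\<close>
lemma Cauchy_formula_arc_left:
  assumes R: "R > 0" and V: "convex V" "open V" "0 \<in> V" and f: "f holomorphic_on V"
    and \<gamma>: "valid_path \<gamma>" "path_image \<gamma> \<subseteq> ({z. Re z \<le> 0} - {0}) \<inter> V"
    and ends: "pathstart \<gamma> = \<i> * of_real R" "pathfinish \<gamma> = - (\<i> * of_real R)"
    and arc: "path_image (part_circlepath 0 R (-(pi/2)) (pi/2)) \<subseteq> V"
  shows "contour_integral (part_circlepath 0 R (-(pi/2)) (pi/2)) (\<lambda>z. f z / z)
       + contour_integral \<gamma> (\<lambda>z. f z / z) = 2 * pi * \<i> * f 0"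
proof -
  define \<alpha> where "\<alpha> = part_circlepath 0 R (-(pi/2)) (pi/2)"
  have \<alpha>: "valid_path \<alpha>" "pathfinish \<alpha> = pathstart \<gamma>" "pathstart \<alpha> = pathfinish \<gamma>"
    by (simp_all add: \<alpha>_def ends exp_eq_polar mult.commute flip: cis_conv_exp)
  have "0 \<notin> path_image \<alpha>"
    using in_path_image_part_circlepath[of 0 0 R "-(pi/2)" "pi/2"] R by (auto simp: \<alpha>_def)
  then have img: "path_image (\<alpha> +++ \<gamma>) \<subseteq> V - {0}"
    unfolding path_image_join[OF \<alpha>(2)] using \<gamma> arc by (auto simp: \<alpha>_def)
  have loop: "valid_path (\<alpha> +++ \<gamma>)" "pathfinish (\<alpha> +++ \<gamma>) = pathstart (\<alpha> +++ \<gamma>)"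
    using \<alpha> \<gamma> by (auto intro: valid_path_join)
  have "((\<lambda>z. 1 / z) has_contour_integral (\<i> * of_real (pi/2 - (-(pi/2))) + \<i> * of_real pi)) (\<alpha> +++ \<gamma>)"
    using \<alpha> \<gamma> has_contour_integral_inverse_arc[of "-(pi/2)" "pi/2" R] R ends
    by (intro has_contour_integral_join has_contour_integral_inverse_left[of R]) (auto simp: \<alpha>_def)
  then have w: "winding_number (\<alpha> +++ \<gamma>) 0 = 1"
    using img loop winding_number_valid_path[of "\<alpha> +++ \<gamma>" 0]
    by (auto simp: contour_integral_unique)
  have "((\<lambda>w. f w / (w - 0)) has_contour_integral (2 * pi * \<i> * winding_number (\<alpha> +++ \<gamma>) 0 * f 0)) (\<alpha> +++ \<gamma>)"
    using V loop img by (intro Cauchy_integral_formula_convex_simple[OF _ f]) (auto simp: interior_open)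
  then have ci: "((\<lambda>w. f w / w) has_contour_integral (2 * pi * \<i> * f 0)) (\<alpha> +++ \<gamma>)"
    by (simp add: w)
  then have "(\<lambda>w. f w / w) contour_integrable_on (\<alpha> +++ \<gamma>)"
    by (auto simp: contour_integrable_on_def)
  then have "(\<lambda>w. f w / w) contour_integrable_on \<alpha>" "(\<lambda>w. f w / w) contour_integrable_on \<gamma>"
    using \<alpha> \<gamma> contour_integrable_joinD1 contour_integrable_joinD2 by blast+
  then have "contour_integral (\<alpha> +++ \<gamma>) (\<lambda>w. f w / w)
      = contour_integral \<alpha> (\<lambda>w. f w / w) + contour_integral \<gamma> (\<lambda>w. f w / w)"
    using \<alpha> \<gamma> by simp
  with contour_integral_unique[OF ci] show ?thesis
    by (simp add: \<alpha>_def)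
qed

text \<open>
  Newman's kernel.  The exponential balances the growth of partial sums and remainders, and the factor
  \<open>1 + z\<^sup>2 / R\<^sup>2\<close> vanishes at \<open>\<plusminus> \<i> R\<close>, where the bounds on the integrands blow up.
\<close>
definition newman_kernel :: "real \<Rightarrow> real \<Rightarrow> complex \<Rightarrow> complex" where
  "newman_kernel T R z = exp (of_real T * z) * (1 + z\<^sup>2 / of_real (R\<^sup>2))"

lemma newman_kernel_0 [simp]: "newman_kernel T R 0 = 1"
  by (simp add: newman_kernel_def)

lemma holomorphic_on_newman_kernel [holomorphic_intros]:
  assumes "f holomorphic_on A"
  shows "(\<lambda>z. newman_kernel T R (f z)) holomorphic_on A"
proof (cases "R = 0")
  case False
  then show ?thesis
    unfolding newman_kernel_def using assms by (intro holomorphic_intros) auto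
next
  case True
  then show ?thesis
    unfolding newman_kernel_def using assms by (auto intro!: holomorphic_intros)
qed

lemma continuous_on_newman_kernel [continuous_intros]:
  assumes "continuous_on A f"
  shows "continuous_on A (\<lambda>z. newman_kernel T R (f z))"
  by (rule continuous_on_compose2[OF holomorphic_on_imp_continuous_on
        [OF holomorphic_on_newman_kernel[where A=UNIV, OF holomorphic_on_ident]] assms]) auto

text \<open>
  On the circle \<open>z (cnj z) = R\<^sup>2\<close>, so \<open>1 + z\<^sup>2 / R\<^sup>2 = z (cnj z + z) / R\<^sup>2\<close>.
\<close>
lemma norm_newman_kernel_circle:
  assumes "norm z = R" "R > 0"
  shows "norm (newman_kernel T R z / z) = exp (T * Re z) * (2 * \<bar>Re z\<bar> / R\<^sup>2)"
proof -
  have R_nz: "complex_of_real (R\<^sup>2) \<noteq> 0" using assms by simp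
  have "of_real (R\<^sup>2) = z * cnj z"
    using assms complex_norm_square[of z] by simp
  then have "1 + z\<^sup>2 / of_real (R\<^sup>2) = (z * cnj z + z\<^sup>2) / of_real (R\<^sup>2)"
    using R_nz by (metis add_divide_distrib divide_self)
  also have "z * cnj z + z\<^sup>2 = z * of_real (2 * Re z)"
    using complex_add_cnj[of z] by (simp add: power2_eq_square add.commute flip: distrib_left)
  finally have "newman_kernel T R z / z = exp (of_real T * z) * (of_real (2 * Re z) / of_real (R\<^sup>2))"
    using assms by (auto simp: newman_kernel_def)
  then show ?thesis
    by (simp add: norm_mult norm_divide norm_power)
qed

text \<open>
  The factor \<open>1 / \<bar>Re z\<bar>\<close> in the bound on \<open>f\<close> is cancelled by the kernel, so the integral over a
  half circle is of order \<open>1 / R\<close> uniformly in \<open>T\<close>.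
\<close>
lemma newman_arc_bound:
  assumes R: "R > 0" and C: "C \<ge> 0" and e: "e \<ge> 0" and ab: "b - a = pi"
    and cont: "continuous_on (path_image (part_circlepath 0 R a b)) f"
    and f: "\<And>z. z \<in> path_image (part_circlepath 0 R a b) \<Longrightarrow> Re z \<noteq> 0
              \<Longrightarrow> norm (f z) \<le> C * exp (- T * Re z) * (1 / \<bar>Re z\<bar> + e)"
  shows "norm (contour_integral (part_circlepath 0 R a b) (\<lambda>z. f z * newman_kernel T R z / z))
           \<le> 2 * pi * C * (1 / R + e)"
proof -
  define \<gamma> where "\<gamma> = part_circlepath 0 R a b"
  have ab': "a \<le> b" using ab pi_gt_zero by linarith
  have nz: "norm z = R" if "z \<in> path_image \<gamma>" for z
    using in_path_image_part_circlepath[of z 0 R a b] that R ab' by (simp add: \<gamma>_def)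
  have bound: "norm (f z * newman_kernel T R z / z) \<le> C * (2 / R\<^sup>2 + 2 * e / R)" if z: "z \<in> path_image \<gamma>" for z
  proof (cases "Re z = 0")
    case True
    then have "norm (newman_kernel T R z / z) = 0"
      using norm_newman_kernel_circle[OF nz[OF z] R] by simp
    then show ?thesis using C e R by auto
  next
    case False
    have re: "\<bar>Re z\<bar> \<le> R" using abs_Re_le_cmod[of z] nz[OF z] by simp
    have "norm (f z * newman_kernel T R z / z) = norm (f z) * norm (newman_kernel T R z / z)"
      by (simp add: norm_mult norm_divide)
    also have "\<dots> = norm (f z) * (exp (T * Re z) * (2 * \<bar>Re z\<bar> / R\<^sup>2))"
      using norm_newman_kernel_circle[OF nz[OF z] R] by simp
    also have "\<dots> \<le> C * exp (- T * Re z) * (1 / \<bar>Re z\<bar> + e) * (exp (T * Re z) * (2 * \<bar>Re z\<bar> / R\<^sup>2))"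
      using f[OF z[unfolded \<gamma>_def] False] by (intro mult_right_mono) auto
    also have "\<dots> = C * (2 / R\<^sup>2 + 2 * e * \<bar>Re z\<bar> / R\<^sup>2)"
      using False R by (simp add: exp_minus field_simps)
    also have "\<dots> \<le> C * (2 / R\<^sup>2 + 2 * e * R / R\<^sup>2)"
      using C e R re by (intro mult_left_mono add_left_mono divide_right_mono) auto
    finally show ?thesis using R by (simp add: power2_eq_square)
  qed
  have "continuous_on (path_image \<gamma>) (\<lambda>z. f z * newman_kernel T R z / z)"
    using nz R cont by (intro continuous_intros) (force simp: \<gamma>_def)+
  then have "(\<lambda>z. f z * newman_kernel T R z / z) contour_integrable_on \<gamma>"
    unfolding \<gamma>_def by (rule contour_integrable_continuous_part_circlepath)
  then have "norm (contour_integral \<gamma> (\<lambda>z. f z * newman_kernel T R z / z)) \<le> (C * (2 / R\<^sup>2 + 2 * e / R)) * R * \<bar>b - a\<bar>"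
    unfolding \<gamma>_def using bound C R e
    by (intro contour_integral_bound_part_circlepath) (auto simp: \<gamma>_def)
  also have "\<dots> = 2 * pi * C * (1 / R + e)"
    using R by (simp add: ab field_simps power2_eq_square)
  finally show ?thesis by (simp add: \<gamma>_def)
qed

lemma closed_segment_left_half_plane:
  assumes "z \<in> closed_segment (\<i> * of_real s) (- of_real d)" "s \<noteq> 0" "d > 0"
  shows "Re z \<le> 0" "z \<noteq> 0"
proof -
  obtain u where u: "0 \<le> u" "u \<le> 1" "z = (1 - u) *\<^sub>R (\<i> * of_real s) + u *\<^sub>R (- of_real d)"
    using assms(1) by (auto simp: in_segment)
  then have z: "Re z = - (u * d)" "Im z = (1 - u) * s" by simp_all
  show "Re z \<le> 0" using z u assms by simp
  show "z \<noteq> 0"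
  proof
    assume "z = 0"
    then have "u * d = 0" "(1 - u) * s = 0" unfolding z[symmetric] using z by simp_all
    then show False using assms by simp
  qed
qed

text \<open>
  On a segment that leaves the imaginary axis at a zero of the kernel, the kernel is of size
  \<open>u exp (- T d u)\<close> at distance proportional to \<open>u\<close> from that point, and this is at most \<open>1 / (T d)\<close>.
  So the integrand tends to \<open>0\<close> uniformly along the segment.
\<close>
lemma newman_segment_tendsto:
  assumes R: "R > 0" and d: "d > 0" and s: "s = R \<or> s = - R"
    and cont: "continuous_on (closed_segment (\<i> * of_real s) (- of_real d)) g"
    and T: "filterlim T at_top sequentially"
  shows "(\<lambda>n. contour_integral (linepath (\<i> * of_real s) (- of_real d)) (\<lambda>z. g z * newman_kernel (T n) R z / z)) \<longlonglongrightarrow> 0"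
proof -
  define A where "A = \<i> * of_real s"
  define D where "D = (- of_real d :: complex)"
  define q where "q = (\<lambda>z. g z * (z + A) / (of_real (R\<^sup>2) * z))"
  have s0: "s \<noteq> 0" "s\<^sup>2 = R\<^sup>2" using s R by auto
  have nz: "z \<noteq> 0" if "z \<in> closed_segment A D" for z
    using closed_segment_left_half_plane[of z s d] that s0 d by (simp add: A_def D_def)
  have contq: "continuous_on (closed_segment A D) q"
    unfolding q_def using nz R cont by (intro continuous_intros) (auto simp: A_def D_def)
  obtain M where M: "\<And>z. z \<in> closed_segment A D \<Longrightarrow> norm (q z) \<le> M" "M > 0"
    using compact_imp_bounded[OF compact_continuous_image[OF contq compact_segment]]
    by (auto simp: bounded_pos)
  have id: "g z * newman_kernel t R z / z = q z * (exp (of_real t * z) * (z - A))" if "z \<in> closed_segment A D" for z t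
  proof -
    have "1 + z\<^sup>2 / of_real (R\<^sup>2) = (z + A) * (z - A) / of_real (R\<^sup>2)"
      using R s0 by (simp add: A_def field_simps power2_eq_square flip: of_real_power of_real_mult)
    then show ?thesis using nz[OF that] by (simp add: newman_kernel_def q_def)
  qed
  have bound: "norm (g z * newman_kernel t R z / z) \<le> M * (norm (D - A) / (t * d))"
    if z: "z \<in> closed_segment A D" and t: "t > 0" for z t
  proof -
    obtain u where u: "0 \<le> u" "u \<le> 1" and zu: "z = (1 - u) *\<^sub>R A + u *\<^sub>R D"
      using z by (auto simp: in_segment)
    have "z - A = u *\<^sub>R (D - A)" by (simp add: zu algebra_simps)
    then have "norm (exp (of_real t * z) * (z - A)) = exp (t * Re z) * (u * norm (D - A))"
      using u by (simp add: norm_mult)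
    also have "Re z = - (u * d)" by (simp add: zu A_def D_def)
    also have "exp (t * - (u * d)) * (u * norm (D - A)) = (u * exp (- (t * d * u))) * norm (D - A)"
      by (simp add: mult_ac)
    also have "u * exp (- (t * d * u)) \<le> 1 / (t * d)"
    proof -
      have "t * d * u \<le> exp (t * d * u)" using exp_ge_add_one_self[of "t * d * u"] by linarith
      then show ?thesis using t d by (simp add: exp_minus field_simps)
    qed
    finally have "norm (exp (of_real t * z) * (z - A)) \<le> norm (D - A) / (t * d)"
      by (simp add: mult_right_mono)
    then show ?thesis
      unfolding id[OF z] norm_mult[of "q z"] using M z by (intro mult_mono) auto
  qed
  have conti: "continuous_on (closed_segment A D) (\<lambda>z. g z * newman_kernel t R z / z)" for t
    using nz cont by (intro continuous_intros) (auto simp: A_def D_def)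
  have "norm (contour_integral (linepath A D) (\<lambda>z. g z * newman_kernel (T n) R z / z))
         \<le> M * (norm (D - A) / (T n * d)) * norm (D - A)" if "T n > 0" for n
    using that bound M d by (intro contour_integral_bound_linepath contour_integrable_continuous_linepath conti) auto
  then have ev: "\<forall>\<^sub>F n in sequentially. norm (contour_integral (linepath A D) (\<lambda>z. g z * newman_kernel (T n) R z / z))
         \<le> M * (norm (D - A) / (T n * d)) * norm (D - A)"
    using filterlim_at_top_dense[THEN iffD1, OF T, rule_format, of 0] by (auto elim: eventually_mono)
  have "(\<lambda>n. M * norm (D - A) * norm (D - A) / d * inverse (T n)) \<longlonglongrightarrow> 0"
    by (rule tendsto_mult_right_zero[OF tendsto_inverse_0_at_top[OF T]])
  then have "(\<lambda>n. M * (norm (D - A) / (T n * d)) * norm (D - A)) \<longlonglongrightarrow> 0"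
    by (simp add: field_simps)
  then show ?thesis
    using Lim_null_comparison[OF ev] by (simp add: A_def D_def)
qed


lemma newman_left_path_tendsto:
  assumes R: "R > 0" and d: "d > 0"
    and \<gamma>: "\<gamma> = linepath (\<i> * of_real R) (- of_real d) +++ linepath (- of_real d) (- (\<i> * of_real R))"
    and cont: "continuous_on (path_image \<gamma>) g"
    and T: "filterlim T at_top sequentially"
  shows "(\<lambda>n. contour_integral \<gamma> (\<lambda>z. g z * newman_kernel (T n) R z / z)) \<longlonglongrightarrow> 0"
proof -
  define A where "A = \<i> * complex_of_real R"
  define D where "D = (- of_real d :: complex)"
  have img: "path_image \<gamma> = closed_segment A D \<union> closed_segment D (- A)"
    unfolding \<gamma> by (subst path_image_join) (auto simp: A_def D_def)
  have c: "continuous_on (closed_segment A D) g" "continuous_on (closed_segment (- A) D) g"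
    using cont unfolding img by (auto intro: continuous_on_subset simp: closed_segment_commute)
  have nz: "z \<noteq> 0" if "z \<in> closed_segment A D \<union> closed_segment (- A) D" for z
    using closed_segment_left_half_plane[of z R d] closed_segment_left_half_plane[of z "- R" d] that R d
    by (auto simp: A_def D_def)
  let ?f = "\<lambda>n z. g z * newman_kernel (T n) R z / z"
  have int: "?f n contour_integrable_on linepath A D" "?f n contour_integrable_on linepath (- A) D"
    for n using nz c by (auto intro!: contour_integrable_continuous_linepath continuous_intros)
  have "contour_integral (linepath D (- A)) (?f n) = - contour_integral (linepath (- A) D) (?f n)" for n
    using contour_integral_reversepath[of "linepath (- A) D" "?f n"] by simp
  moreover have "?f n contour_integrable_on linepath D (- A)" for n
    using contour_integrable_reversepath[OF _ int(2), of n] by simp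
  ultimately have "contour_integral \<gamma> (?f n)
      = contour_integral (linepath A D) (?f n) - contour_integral (linepath (- A) D) (?f n)" for n
    using int unfolding \<gamma> by (simp add: A_def D_def)
  moreover have "(\<lambda>n. contour_integral (linepath A D) (?f n) - contour_integral (linepath (- A) D) (?f n)) \<longlonglongrightarrow> 0 - 0"
    using newman_segment_tendsto[OF R d _ _ T, of R g] newman_segment_tendsto[OF R d _ _ T, of "-R" g] c
    by (intro tendsto_diff) (simp_all add: A_def D_def)
  ultimately show ?thesis by simp
qed

lemma right_half_plane_margin:
  fixes U :: "complex set"
  assumes U: "open U" "{z. Re z \<ge> 0} \<subseteq> U"
  obtains d where "d > 0" "{z. Re z > - d \<and> \<bar>Im z\<bar> < K} \<subseteq> U"
proof -
  obtain e where e: "e > 0" "(\<Union>x\<in>closed_segment (- (\<i> * of_real K)) (\<i> * of_real K). ball x e) \<subseteq> U"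
  proof (rule compact_subset_open_imp_ball_epsilon_subset[OF compact_segment U(1)])
    show "closed_segment (- (\<i> * of_real K)) (\<i> * of_real K) \<subseteq> U"
      using U(2) by (force simp: in_segment)
  qed blast
  have "z \<in> U" if z: "Re z > - e" "\<bar>Im z\<bar> < K" for z
  proof (cases "Re z \<ge> 0")
    case False
    define w where "w = \<i> * complex_of_real (Im z)"
    have "w = (1 - (Im z + K) / (2 * K)) *\<^sub>R (- (\<i> * of_real K)) + ((Im z + K) / (2 * K)) *\<^sub>R (\<i> * of_real K)"
      using z by (simp add: w_def complex_eq_iff field_simps)
    moreover have "0 \<le> (Im z + K) / (2 * K)" "(Im z + K) / (2 * K) \<le> 1"
      using z by (auto simp: field_simps)
    ultimately have "w \<in> closed_segment (- (\<i> * of_real K)) (\<i> * of_real K)"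
      unfolding in_segment by blast
    moreover have "dist w z < e"
    proof -
      have "z - w = of_real (Re z)" by (simp add: w_def complex_eq_iff)
      then have "norm (z - w) = \<bar>Re z\<bar>" by (simp only: norm_of_real)
      then show ?thesis using z False by (simp add: dist_norm norm_minus_commute)
    qed
    ultimately show ?thesis using e(2) by fastforce
  qed (use assms in auto)
  with e(1) that show thesis by blast
qed

text \<open>
  With \<open>\<alpha>\<close> and \<open>\<beta>\<close> the right and left half circles and \<open>\<gamma>\<close> the two segments from \<open>\<i> R\<close> via \<open>- d\<close> to
  \<open>- \<i> R\<close>, Cauchy's formula gives \<open>2 \<pi> \<i> (g 0 - S n 0)\<close> as the integral of the remainder over \<open>\<alpha>\<close>, plus that of
  \<open>g\<close> over \<open>\<gamma>\<close>, minus that of \<open>S n\<close> over \<open>\<beta>\<close>.  The first and the last are \<open>O(1 / R)\<close>, and the second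
  tends to \<open>0\<close>.
\<close>
lemma newman_radius_bound:
  fixes g :: "complex \<Rightarrow> complex" and S :: "nat \<Rightarrow> complex \<Rightarrow> complex"
  assumes U: "open U" "{z. Re z \<ge> 0} \<subseteq> U" and g: "g holomorphic_on U"
    and S: "\<And>n. S n holomorphic_on UNIV"
    and T: "filterlim T at_top sequentially" and e: "e \<longlonglongrightarrow> 0" "\<And>n. e n \<ge> 0" and B: "B \<ge> 0"
    and right: "\<And>n z. Re z > 0 \<Longrightarrow> norm (g z - S n z) \<le> B * exp (- T n * Re z) / Re z"
    and left: "\<And>n z. Re z < 0 \<Longrightarrow> norm (S n z) \<le> B * exp (- T n * Re z) * (1 / \<bar>Re z\<bar> + e n)"
    and R: "R > 0"
  shows "\<forall>\<^sub>F n in sequentially. norm (g 0 - S n 0) < (2 * B + 1) / R"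
proof -
  obtain \<epsilon> where \<epsilon>: "\<epsilon> > 0" "{z. Re z > - \<epsilon> \<and> \<bar>Im z\<bar> < 2 * R} \<subseteq> U"
    using right_half_plane_margin[OF U] by blast
  define V where "V = {z. Re z > - \<epsilon>} \<inter> ({z. Im z < 2 * R} \<inter> {z. Im z > - (2 * R)})"
  have V: "open V" "convex V" "0 \<in> V" "V \<subseteq> U"
    using \<epsilon> R by (auto simp: V_def open_halfspace_Re_gt open_halfspace_Im_lt open_halfspace_Im_gt
        convex_halfspace_Re_gt convex_halfspace_Im_lt convex_halfspace_Im_gt intro!: convex_Int open_Int)
  define \<alpha> where "\<alpha> = part_circlepath 0 R (-(pi/2)) (pi/2)"
  define \<beta> where "\<beta> = part_circlepath 0 R (pi/2) (3*pi/2)"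
  define d where "d = \<epsilon> / 2"
  have d: "d > 0" using \<epsilon> by (simp add: d_def)
  define \<gamma> where "\<gamma> = linepath (\<i> * of_real R) (- of_real d) +++ linepath (- of_real d) (- (\<i> * of_real R))"
  have img\<gamma>: "path_image \<gamma> = closed_segment (\<i> * of_real R) (- of_real d) \<union> closed_segment (- of_real d) (- (\<i> * of_real R))"
    unfolding \<gamma>_def by (subst path_image_join) auto
  have ivl: "closed_segment (-(pi/2)) (pi/2) = {-(pi/2)..pi/2}" "closed_segment (pi/2) (3*pi/2) = {pi/2..3*pi/2}"
    by (simp_all add: closed_segment_eq_real_ivl)
  have \<alpha>_Re: "Re z \<ge> 0" "norm z = R" if z: "z \<in> path_image \<alpha>" for z
  proof -
    obtain t where t: "t \<in> {-(pi/2)..pi/2}" "z = 0 + of_real R * cis t"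
      using z unfolding \<alpha>_def path_image_part_circlepath' ivl by blast
    then show "Re z \<ge> 0" "norm z = R" using R cos_ge_zero[of t] by (auto simp: norm_mult)
  qed
  have \<beta>_Re: "Re z \<le> 0" "norm z = R" if z: "z \<in> path_image \<beta>" for z
  proof -
    obtain t where t: "t \<in> {pi/2..3*pi/2}" "z = 0 + of_real R * cis t"
      using z unfolding \<beta>_def path_image_part_circlepath' ivl by blast
    have "cos (t - pi) \<ge> 0" using t by (intro cos_ge_zero) auto
    then show "Re z \<le> 0" "norm z = R" using R t by (auto simp: norm_mult mult_nonneg_nonpos)
  qed
  have \<alpha>V: "path_image \<alpha> \<subseteq> V"
  proof
    fix z assume "z \<in> path_image \<alpha>"
    then have "Re z \<ge> 0" "\<bar>Im z\<bar> < 2 * R" using \<alpha>_Re[of z] abs_Im_le_cmod[of z] R by auto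
    then show "z \<in> V" using \<epsilon>(1) by (auto simp: V_def)
  qed
  have \<gamma>_V: "path_image \<gamma> \<subseteq> V"
    unfolding img\<gamma> using V(2) R \<epsilon> d
    by (intro Un_least closed_segment_subset) (auto simp: V_def d_def)
  have \<gamma>_left: "path_image \<gamma> \<subseteq> {z. Re z \<le> 0} - {0}"
  proof
    fix z assume "z \<in> path_image \<gamma>"
    then show "z \<in> {z. Re z \<le> 0} - {0}"
      using closed_segment_left_half_plane[of z R d] closed_segment_left_half_plane[of z "- R" d] R d
      unfolding img\<gamma> by (auto simp: closed_segment_commute)
  qed
  have \<beta>_left: "path_image \<beta> \<subseteq> {z. Re z \<le> 0} - {0}"
    using \<beta>_Re R by fastforce
  have e1: "exp (\<i> * of_real pi / 2) = \<i>"
    using cis_conv_exp[of "pi / 2"] by simp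
  have e3: "exp (\<i> * (of_real pi * 3) / 2) = - \<i>"
    using cis_conv_exp[of "pi + pi / 2"] cis_mult[of pi "pi / 2"] by (simp add: field_simps)
  have ends: "valid_path \<gamma>" "pathstart \<gamma> = \<i> * of_real R" "pathfinish \<gamma> = - (\<i> * of_real R)"
    "valid_path \<beta>" "pathstart \<beta> = \<i> * of_real R" "pathfinish \<beta> = - (\<i> * of_real R)"
    by (simp_all add: \<gamma>_def \<beta>_def e1 e3 mult.commute[of 3])
  define K where "K n = newman_kernel (T n) R" for n
  have holoK: "K n holomorphic_on A" for n A
    unfolding K_def using holomorphic_on_newman_kernel[OF holomorphic_on_ident] .
  have F1: "contour_integral \<alpha> (\<lambda>z. g z * K n z / z) + contour_integral \<gamma> (\<lambda>z. g z * K n z / z) = 2 * pi * \<i> * g 0" for n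
    using Cauchy_formula_arc_left[OF R V(2,1,3), of "\<lambda>z. g z * K n z" \<gamma>] ends \<gamma>_V \<gamma>_left \<alpha>V
      holomorphic_on_mult[OF holomorphic_on_subset[OF g V(4)] holoK]
    by (auto simp: K_def \<alpha>_def)
  have F2: "contour_integral \<alpha> (\<lambda>z. S n z * K n z / z) + contour_integral \<beta> (\<lambda>z. S n z * K n z / z) = 2 * pi * \<i> * S n 0" for n
    using Cauchy_formula_arc_left[OF R, of UNIV "\<lambda>z. S n z * K n z" \<beta>] ends \<beta>_left
      holomorphic_on_mult[OF S holoK]
    by (auto simp: K_def \<alpha>_def)
  have cg: "continuous_on (path_image \<alpha>) g" "continuous_on (path_image \<gamma>) g"
    using \<alpha>V \<gamma>_V V(4) by (meson continuous_on_subset g holomorphic_on_imp_continuous_on order_trans)+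
  have cS: "continuous_on A (S n)" for A n
    using holomorphic_on_imp_continuous_on[OF S[of n]] continuous_on_subset by blast
  have int: "(\<lambda>z. f z * K n z / z) contour_integrable_on \<alpha>" if "continuous_on (path_image \<alpha>) f" for f n
    unfolding \<alpha>_def K_def using that \<alpha>_Re(2) R
    by (intro contour_integrable_continuous_part_circlepath continuous_intros) (force simp: \<alpha>_def)+
  have diff: "contour_integral \<alpha> (\<lambda>z. (g z - S n z) * K n z / z)
      = contour_integral \<alpha> (\<lambda>z. g z * K n z / z) - contour_integral \<alpha> (\<lambda>z. S n z * K n z / z)" for n
    using contour_integral_diff[OF int[OF cg(1)] int[OF cS]]
    by (simp add: left_diff_distrib diff_divide_distrib)
  define I where "I n = contour_integral \<gamma> (\<lambda>z. g z * K n z / z)" for n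
  have I: "I \<longlonglongrightarrow> 0"
    unfolding I_def K_def using newman_left_path_tendsto[OF R d \<gamma>_def cg(2) T] .
  have b1: "norm (contour_integral \<alpha> (\<lambda>z. (g z - S n z) * K n z / z)) \<le> 2 * pi * B * (1 / R + 0)" for n
    unfolding K_def \<alpha>_def
  proof (rule newman_arc_bound[OF R B])
    show "continuous_on (path_image (part_circlepath 0 R (- (pi / 2)) (pi / 2))) (\<lambda>z. g z - S n z)"
      using cg(1) cS by (auto intro!: continuous_intros simp: \<alpha>_def)
  next
    fix z assume "z \<in> path_image (part_circlepath 0 R (- (pi / 2)) (pi / 2))" "Re z \<noteq> 0"
    then show "norm (g z - S n z) \<le> B * exp (- T n * Re z) * (1 / \<bar>Re z\<bar> + 0)"
      using right[of z n] \<alpha>_Re(1)[of z] by (auto simp: \<alpha>_def)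
  qed auto
  have b2: "norm (contour_integral \<beta> (\<lambda>z. S n z * K n z / z)) \<le> 2 * pi * B * (1 / R + e n)" for n
    unfolding K_def \<beta>_def
  proof (rule newman_arc_bound[OF R B e(2)])
    fix z assume "z \<in> path_image (part_circlepath 0 R (pi / 2) (3 * pi / 2))" "Re z \<noteq> 0"
    then show "norm (S n z) \<le> B * exp (- T n * Re z) * (1 / \<bar>Re z\<bar> + e n)"
      using left[of z n] \<beta>_Re(1)[of z] by (auto simp: \<beta>_def)
  qed (auto intro: cS)
  have main: "norm (g 0 - S n 0) \<le> 2 * B / R + B * e n + norm (I n) / (2 * pi)" for n
  proof -
    have add_diff_swap: "(a + b) - (c + d) = (a - c) + b - d" for a b c d :: complex by simp
    have "2 * pi * \<i> * (g 0 - S n 0) = 2 * pi * \<i> * g 0 - 2 * pi * \<i> * S n 0"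
      by (rule right_diff_distrib)
    also have "\<dots> = contour_integral \<alpha> (\<lambda>z. (g z - S n z) * K n z / z)
             + I n - contour_integral \<beta> (\<lambda>z. S n z * K n z / z)"
      unfolding F1[of n, symmetric] F2[of n, symmetric] diff I_def by (rule add_diff_swap)
    finally have eq: "2 * pi * \<i> * (g 0 - S n 0) = contour_integral \<alpha> (\<lambda>z. (g z - S n z) * K n z / z)
             + I n - contour_integral \<beta> (\<lambda>z. S n z * K n z / z)" .
    have "norm (2 * pi * \<i> * (g 0 - S n 0)) \<le> norm (contour_integral \<alpha> (\<lambda>z. (g z - S n z) * K n z / z))
       + norm (I n) + norm (contour_integral \<beta> (\<lambda>z. S n z * K n z / z))"
      unfolding eq by (rule order_trans[OF norm_triangle_ineq4 add_right_mono[OF norm_triangle_ineq]])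
    also have "\<dots> \<le> 2 * pi * B * (1 / R + 0) + norm (I n) + 2 * pi * B * (1 / R + e n)"
      by (intro add_mono b1 b2 order_refl)
    also have "\<dots> = (2 * pi) * (2 * B / R + B * e n + norm (I n) / (2 * pi))"
      by (simp add: algebra_simps)
    also have "norm (2 * pi * \<i> * (g 0 - S n 0)) = (2 * pi) * norm (g 0 - S n 0)"
      by (simp add: norm_mult)
    finally show ?thesis
      by (rule mult_left_le_imp_le) simp
  qed
  have "(\<lambda>n. 2 * B / R + B * e n + norm (I n) / (2 * pi)) \<longlonglongrightarrow> 2 * B / R + B * 0 + norm (0::complex) / (2 * pi)"
    using I e(1) by (intro tendsto_intros) auto
  moreover have "2 * B / R + B * 0 + norm (0::complex) / (2 * pi) < (2 * B + 1) / R"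
    using R by (simp add: field_simps)
  ultimately have "\<forall>\<^sub>F n in sequentially. 2 * B / R + B * e n + norm (I n) / (2 * pi) < (2 * B + 1) / R"
    by (rule order_tendstoD)
  then show ?thesis
    using main by (auto elim!: eventually_mono intro: le_less_trans)
qed

text \<open>
  The hypotheses \<open>right\<close> and \<open>left\<close> are what boundedness of the coefficients gives for a series over
  \<open>k\<^bsup>-1-z\<^esup>\<close>: comparison of the tail and of the partial sum with an integral, with \<open>T n\<close> the logarithm of
  the length.  The term \<open>e n\<close> absorbs the last summand of the partial sum, which exceeds the
  integral when \<open>Re z < -1\<close>.
\<close>
theorem newman_tauberian:
  fixes g :: "complex \<Rightarrow> complex" and S :: "nat \<Rightarrow> complex \<Rightarrow> complex"
  assumes U: "open U" "{z. Re z \<ge> 0} \<subseteq> U" and g: "g holomorphic_on U"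
    and S: "\<And>n. S n holomorphic_on UNIV"
    and T: "filterlim T at_top sequentially" and e: "e \<longlonglongrightarrow> 0" "\<And>n. e n \<ge> 0" and B: "B \<ge> 0"
    and right: "\<And>n z. Re z > 0 \<Longrightarrow> norm (g z - S n z) \<le> B * exp (- T n * Re z) / Re z"
    and left: "\<And>n z. Re z < 0 \<Longrightarrow> norm (S n z) \<le> B * exp (- T n * Re z) * (1 / \<bar>Re z\<bar> + e n)"
  shows "(\<lambda>n. S n 0) \<longlonglongrightarrow> g 0"
proof (rule tendstoI)
  fix \<delta> :: real assume \<delta>: "\<delta> > 0"
  define R where "R = (2 * B + 1) / \<delta>"
  have R: "R > 0" "(2 * B + 1) / R = \<delta>" using B \<delta> by (auto simp: R_def)
  show "\<forall>\<^sub>F n in sequentially. dist (S n 0) (g 0) < \<delta>"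
    using newman_radius_bound[OF U g S T e B right left R(1)]
    unfolding R(2) dist_norm norm_minus_commute[of "g 0"] .
qed

section \<open>The zeta function to the right of the line Re s = 0\<close>

lemma norm_nat_powr: "norm (of_nat n powr s :: complex) = real n powr Re s"
  using norm_powr_real_powr[of "of_nat n" s] by (cases "n = 0") auto

text \<open>
  The error in replacing the difference of \<open>x\<^bsup>-w\<^esup>\<close> over \<open>[k, k + 1]\<close> by the derivative at \<open>k\<close>.  It is
  of order \<open>k\<^bsup>-w-2\<^esup>\<close>, one power below the derivative, so series with these terms converge in larger
  half-planes; they provide every holomorphic continuation below.  The value at \<open>k = 0\<close> is set to \<open>0\<close>, in accordance with
  \<open>0 powr s = 0\<close>, so that all series can run over all natural numbers.
\<close>
definition powr_remainder :: "nat \<Rightarrow> complex \<Rightarrow> complex" where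
  "powr_remainder k w = (if k = 0 then 0 else
     of_nat k powr (- w) - of_nat (k + 1) powr (- w) - w * of_nat k powr (- w - 1))"

lemma powr_remainder_0 [simp]: "powr_remainder k 0 = 0"
proof -
  have "1 + of_nat k \<noteq> (0 :: complex)"
    by (metis of_nat_Suc of_nat_eq_0_iff nat.distinct(1))
  then show ?thesis by (auto simp: powr_remainder_def)
qed

lemma holomorphic_powr_remainder: "powr_remainder k holomorphic_on A"
proof -
  have "powr_remainder k = (\<lambda>w. if k = 0 then 0 else
     of_nat k powr (- w) - of_nat (k + 1) powr (- w) - w * of_nat k powr (- w - 1))"
    by (auto simp: powr_remainder_def)
  moreover have "1 + of_nat k \<noteq> (0 :: complex)"
    by (metis of_nat_Suc of_nat_eq_0_iff nat.distinct(1))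
  ultimately show ?thesis by (cases "k = 0") (auto intro!: holomorphic_intros)
qed

lemma norm_powr_remainder_le:
  assumes w: "Re w \<ge> - 2"
  shows "norm (powr_remainder k w) \<le> norm w * norm (w + 1) * real k powr (- Re w - 2)"
proof (cases "k = 0")
  case False
  define f :: "nat \<Rightarrow> complex \<Rightarrow> complex" where
    "f = (\<lambda>i z. if i = 0 then z powr (- w) else if i = 1 then - w * z powr (- w - 1)
              else w * (w + 1) * z powr (- w - 2))"
  define S where "S = closed_segment (of_nat k :: complex) (of_nat (k + 1))"
  have S: "Re z \<ge> k" "Im z = 0" if "z \<in> S" for z
  proof -
    obtain u where u: "0 \<le> u" "u \<le> 1" "z = (1 - u) *\<^sub>R of_nat k + u *\<^sub>R of_nat (k + 1)"
      using \<open>z \<in> S\<close> by (auto simp: S_def in_segment)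
    show "Re z \<ge> k" "Im z = 0" using u by (simp_all add: algebra_simps)
  qed
  have "norm (f 0 (of_nat (k + 1)) - (\<Sum>i\<le>1. f i (of_nat k) * (of_nat (k + 1) - of_nat k) ^ i / fact i))
     \<le> (norm w * norm (w + 1) * real k powr (- Re w - 2)) * norm (of_nat (k + 1) - of_nat k :: complex) ^ Suc 1 / fact 1"
  proof (rule complex_Taylor[of S 1 f])
    show "(f i has_field_derivative f (Suc i) z) (at z within S)" if "z \<in> S" and i: "i \<le> 1" for i z
    proof -
      have "z \<notin> \<real>\<^sub>\<le>\<^sub>0" using S[OF that(1)] False by (auto simp: complex_nonpos_Reals_iff)
      then have p: "((\<lambda>z. z powr r) has_field_derivative r * z powr (r - 1)) (at z within S)" for r
        by (rule has_field_derivative_at_within[OF has_field_derivative_powr])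
      consider "i = 0" | "i = 1" using i by linarith
      then show ?thesis
      proof cases
        case 1
        then show ?thesis using p[of "- w"] by (simp add: f_def)
      next
        case 2
        have "((\<lambda>z. - w * z powr (- w - 1)) has_field_derivative w * (w + 1) * z powr (- w - 2)) (at z within S)"
        proof (rule DERIV_cong[OF DERIV_cmult[OF p]])
          have "- w - 1 - 1 = - w - 2" by simp
          then show "- w * ((- w - 1) * z powr (- w - 1 - 1)) = w * (w + 1) * z powr (- w - 2)"
            by (simp add: algebra_simps)
        qed
        then show ?thesis by (simp add: f_def 2)
      qed
    qed
    show "norm (f (Suc 1) z) \<le> norm w * norm (w + 1) * real k powr (- Re w - 2)" if "z \<in> S" for z
    proof -
      have z: "z = of_real (Re z)" using S[OF that] by (simp add: complex_eq_iff)
      have "norm (z powr (- w - 2)) = Re z powr (- Re w - 2)"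
        using S[OF that] by (subst z, subst norm_powr_real_powr) auto
      also have "\<dots> \<le> real k powr (- Re w - 2)"
        using S[OF that] False w by (intro powr_mono2') auto
      finally show ?thesis by (simp add: f_def norm_mult mult_left_mono)
    qed
  qed (auto simp: S_def)
  then show ?thesis
    using False by (simp add: f_def powr_remainder_def norm_minus_commute algebra_simps)
qed (simp add: powr_remainder_def)

lemma powr_remainder_series:
  fixes c :: "nat \<Rightarrow> complex"
  assumes c: "\<And>k. norm (c k) \<le> B * real k powr j" and j: "j \<ge> 0"
  shows "\<And>w. Re w > j - 1 \<Longrightarrow> summable (\<lambda>k. c k * powr_remainder k w)"
    and "(\<lambda>w. \<Sum>k. c k * powr_remainder k w) holomorphic_on {w. Re w > j - 1}"
proof -
  have B: "B \<ge> 0" using order_trans[OF norm_ge_zero c[of 1]] by simp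
  have bound: "norm (c k * powr_remainder k w) \<le> B * (M * (M + 1)) * real k powr (j - x - 2)"
    if "norm w \<le> M" "Re w \<ge> x" "x > j - 1" for k w M x
  proof (cases "k = 0")
    case False
    have "norm (c k * powr_remainder k w) \<le> (B * real k powr j) * (norm w * norm (w + 1) * real k powr (- Re w - 2))"
      unfolding norm_mult[of "c k"] using that j
      by (intro mult_mono c norm_powr_remainder_le) (auto intro: order_trans[OF norm_ge_zero c])
    also have "\<dots> \<le> (B * real k powr j) * (M * (M + 1) * real k powr (- x - 2))"
      using that B False norm_triangle_ineq[of w 1] order_trans[OF norm_ge_zero that(1)]
      by (intro mult_mono powr_mono mult_nonneg_nonneg) auto
    also have "\<dots> = B * (M * (M + 1)) * (real k powr j * real k powr (- x - 2))"
      by (simp add: mult_ac)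
    also have "real k powr j * real k powr (- x - 2) = real k powr (j - x - 2)"
      by (simp add: powr_add[symmetric] algebra_simps)
    finally show ?thesis .
  qed (simp add: powr_remainder_def)
  have sm: "summable (\<lambda>k. B * (M * (M + 1)) * real k powr (j - x - 2))" if "x > j - 1" for x M
    using that by (intro summable_mult) (auto simp: summable_real_powr_iff)
  show "summable (\<lambda>k. c k * powr_remainder k w)" if "Re w > j - 1" for w
    using summable_comparison_test'[OF sm[OF that], of 0 "\<lambda>k. c k * powr_remainder k w" "norm w"] bound[OF _ _ that, of w "norm w"]
    by auto
  show "(\<lambda>w. \<Sum>k. c k * powr_remainder k w) holomorphic_on {w. Re w > j - 1}"
  proof (rule holomorphic_uniform_sequence[where f = "\<lambda>n w. \<Sum>k<n. c k * powr_remainder k w"])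
    fix w assume "w \<in> {w. Re w > j - 1}"
    then have w: "Re w > j - 1" by simp
    define d where "d = (Re w - (j - 1)) / 2"
    have d: "d > 0" "Re w - d > j - 1" using w by (auto simp: d_def field_simps)
    have z: "Re z \<ge> Re w - d" "norm z \<le> norm w + d" if "z \<in> cball w d" for z
      using that abs_Re_le_cmod[of "w - z"] norm_triangle_ineq2[of z w]
      by (auto simp: dist_norm norm_minus_commute)
    have "uniform_limit (cball w d) (\<lambda>n x. \<Sum>k<n. c k * powr_remainder k x) (\<lambda>x. \<Sum>k. c k * powr_remainder k x) sequentially"
      using z d by (intro Weierstrass_m_test[OF _ sm[OF d(2)]] bound) auto
    moreover have "cball w d \<subseteq> {w. Re w > j - 1}" using z d by force
    ultimately show "\<exists>d. 0 < d \<and> cball w d \<subseteq> {w. Re w > j - 1} \<and> uniform_limit (cball w d)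
        (\<lambda>n x. \<Sum>k<n. c k * powr_remainder k x) (\<lambda>x. \<Sum>k. c k * powr_remainder k x) sequentially"
      using d(1) by blast
  qed (auto intro!: holomorphic_intros holomorphic_powr_remainder simp: open_halfspace_Re_gt)
qed

definition zeta_series :: "complex \<Rightarrow> complex" where
  "zeta_series s = (\<Sum>n. of_nat n powr (- s))"

text \<open>
  This is \<open>(s - 1) \<zeta>(s)\<close> in a form that makes sense for \<open>Re s > 0\<close>: summing
  \<open>k\<^bsup>-w\<^esup> - (k + 1)\<^bsup>-w\<^esup>\<close> over \<open>k \<ge> 1\<close> gives \<open>1\<close>, and with \<open>w = s - 1\<close> the linear parts of these differences add up
  to \<open>(s - 1) \<zeta>(s)\<close>.
\<close>
definition zeta_regularized :: "complex \<Rightarrow> complex" where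
  "zeta_regularized s = 1 - (\<Sum>k. powr_remainder k (s - 1))"

lemma summable_nat_powr: "Re s > 1 \<Longrightarrow> summable (\<lambda>n. norm (of_nat n powr (- s) :: complex))"
  by (simp add: norm_nat_powr summable_real_powr_iff)

lemma zeta_regularized_1 [simp]: "zeta_regularized 1 = 1"
  by (simp add: zeta_regularized_def)

lemma holomorphic_zeta_regularized: "zeta_regularized holomorphic_on {s. Re s > 0}"
proof -
  have one: "norm ((if k = 0 then 0 else 1) :: complex) \<le> 1 * real k powr 0" for k :: nat
    by (cases "k = 0") auto
  have eq: "(\<lambda>k. (if k = 0 then 0 else 1) * powr_remainder k w) = (\<lambda>k. powr_remainder k w)" for w
    by (auto simp: powr_remainder_def)
  have "(\<lambda>w. \<Sum>k. powr_remainder k w) holomorphic_on {w. Re w > 0 - 1}"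
    using powr_remainder_series(2)[OF one order_refl] unfolding eq .
  then have "(\<lambda>w. \<Sum>k. powr_remainder k w) \<circ> (\<lambda>s. s - 1) holomorphic_on {s. Re s > 0}"
    by (intro holomorphic_on_compose_gen[where t = "{w. Re w > 0 - 1}"] holomorphic_intros) auto
  then show ?thesis
    unfolding zeta_regularized_def[abs_def] by (intro holomorphic_intros) (simp add: o_def)
qed

lemma nat_powr_tendsto_0:
  assumes "Re w > 0"
  shows "(\<lambda>n. of_nat (Suc n) powr (- w) :: complex) \<longlonglongrightarrow> 0"
proof (rule tendsto_norm_zero_cancel)
  have "(\<lambda>n. real (Suc n) powr (- Re w)) \<longlonglongrightarrow> 0"
    using assms by (intro tendsto_neg_powr filterlim_compose[OF filterlim_real_sequentially filterlim_Suc]) auto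
  then show "(\<lambda>n. norm (of_nat (Suc n) powr (- w) :: complex)) \<longlonglongrightarrow> 0"
    unfolding norm_nat_powr by simp
qed

lemma zeta_regularized_eq:
  assumes "Re s > 1"
  shows "zeta_regularized s = (s - 1) * zeta_series s"
proof -
  define w where "w = s - 1"
  have w: "Re w > 0" using assms by (simp add: w_def)
  define t where "t k = (if k = 0 then 0 else of_nat k powr (- w) - of_nat (Suc k) powr (- w))" for k :: nat
  have t: "t k = w * of_nat k powr (- s) + powr_remainder k w" for k
    by (auto simp: t_def powr_remainder_def w_def)
  have "(\<Sum>k<Suc n. t k) = 1 - of_nat (Suc n) powr (- w)" for n
    by (induction n) (auto simp: t_def)
  moreover have "(\<lambda>n. 1 - of_nat (Suc n) powr (- w)) \<longlonglongrightarrow> 1 - 0"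
    by (intro tendsto_intros nat_powr_tendsto_0 w)
  ultimately have "t sums 1"
    unfolding sums_def by (subst filterlim_sequentially_Suc[symmetric]) (simp del: sum.lessThan_Suc)
  moreover have "(\<lambda>k. w * of_nat k powr (- s)) sums (w * zeta_series s)"
    unfolding zeta_series_def using summable_norm_cancel[OF summable_nat_powr[OF assms]]
    by (intro sums_mult summable_sums)
  ultimately have "(\<lambda>k. t k - w * of_nat k powr (- s)) sums (1 - w * zeta_series s)"
    by (rule sums_diff)
  then have "(\<lambda>k. powr_remainder k w) sums (1 - w * zeta_series s)"
    by (simp add: t)
  then have "(\<Sum>k. powr_remainder k w) = 1 - w * zeta_series s"
    by (rule sums_unique[symmetric])
  then show ?thesis
    unfolding zeta_regularized_def w_def[symmetric] by simp
qed

section \<open>The Dirichlet series of the von Mangoldt function\<close>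

definition mangoldt_series :: "complex \<Rightarrow> complex" where
  "mangoldt_series s = (\<Sum>n. mangoldt n * of_nat n powr (- s))"

lemma summable_ln_powr:
  assumes "x > 1"
  shows "summable (\<lambda>n. ln (real n) * real n powr (- x))"
proof (rule summable_comparison_test')
  \<comment> \<open>Trading the logarithm for half of the excess over the abscissa of convergence.\<close>
  define e where "e = (x - 1) / 2"
  have e: "e > 0" using assms by (simp add: e_def)
  show "summable (\<lambda>n. (1 / e) * real n powr (e - x))"
    using assms by (intro summable_mult) (auto simp: summable_real_powr_iff e_def field_simps)
  fix n :: nat assume n: "n \<ge> 1"
  have "ln (real n) * real n powr (- x) \<le> (real n powr e / e) * real n powr (- x)"
    using n e by (intro mult_right_mono ln_powr_bound) auto
  also have "\<dots> = (1 / e) * real n powr (e - x)"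
    by (simp add: powr_add[symmetric] powr_diff divide_simps powr_minus)
  finally show "norm (ln (real n) * real n powr (- x)) \<le> (1 / e) * real n powr (e - x)"
    using n by simp
qed

lemma mangoldt_le_ln: "mangoldt n \<le> ln (real n)"
  by (cases "n = 0") (auto simp: mangoldt_le)

lemma summable_mangoldt_powr:
  assumes "x > 1"
  shows "summable (\<lambda>n. mangoldt n * real n powr (- x))"
  using assms mangoldt_le_ln mangoldt_nonneg
  by (intro summable_comparison_test'[OF summable_ln_powr[OF assms], of 0]) (auto intro!: mult_right_mono simp: abs_mult)

lemma norm_mangoldt_powr: "norm (mangoldt n * of_nat n powr (- s) :: complex) = mangoldt n * real n powr (- Re s)"
  by (simp add: norm_mult norm_nat_powr)

lemma zeta_series_deriv:
  assumes "Re s > 1"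
  shows "(zeta_series has_field_derivative (\<Sum>n. - of_real (ln (real n)) * of_nat n powr (- s))) (at s)"
proof -
  define S where "S = {s. Re s > 1}"
  define f where "f = (\<lambda>(n::nat) s. of_nat n powr (- s) :: complex)"
  define f' where "f' = (\<lambda>(n::nat) s. - of_real (ln (real n)) * of_nat n powr (- s) :: complex)"
  have "\<exists>g g'. \<forall>x \<in> S. ((\<lambda>n. f n x) sums g x) \<and> ((\<lambda>n. f' n x) sums g' x) \<and> (g has_field_derivative g' x) (at x)"
  proof (rule series_and_derivative_comparison_complex)
    show "open S" by (simp add: S_def open_halfspace_Re_gt)
    show "(f n has_field_derivative f' n x) (at x)" for n x
    proof (cases "n = 0")
      case False
      have "((\<lambda>z. of_nat n powr z) has_field_derivative Ln (of_nat n) * of_nat n powr (- x)) (at (- x))"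
        using False by (intro has_field_derivative_powr_right) auto
      moreover have "((\<lambda>z. - z) has_field_derivative - 1) (at x)"
        by (auto intro!: derivative_eq_intros)
      ultimately show ?thesis
        using DERIV_chain2 False by (fastforce simp: f_def f'_def Ln_of_nat)
    qed (simp add: f_def f'_def)
    fix x assume x: "x \<in> S"
    \<comment> \<open>Half the distance to the line \<open>Re s = 1\<close>, so that the ball stays in a closed half-plane of uniform
      absolute convergence.\<close>
    define d where "d = (Re x - 1) / 2"
    have d: "d > 0" "Re x - d > 1" using x by (auto simp: d_def S_def field_simps)
    have "norm (f n y) \<le> norm (complex_of_real (real n powr (- (Re x - d))))" if "n \<ge> 1" "y \<in> ball x d \<inter> S" for n y
    proof -
      have "Re y \<ge> Re x - d" using that abs_Re_le_cmod[of "x - y"] by (auto simp: dist_norm)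
      then show ?thesis using that by (simp add: f_def norm_nat_powr powr_mono)
    qed
    then have "\<forall>\<^sub>F n in sequentially. \<forall>y\<in>ball x d \<inter> S. cmod (f n y) \<le> cmod (complex_of_real (real n powr (- (Re x - d))))"
      by (intro eventually_sequentiallyI[of 1]) blast
    moreover have "summable (\<lambda>n. complex_of_real (real n powr (- (Re x - d))))"
      using d by (intro summable_of_real) (auto simp: summable_real_powr_iff)
    moreover have "range (\<lambda>n. complex_of_real (real n powr (- (Re x - d)))) \<subseteq> \<real>\<^sub>\<ge>\<^sub>0"
      by (auto simp: complex_nonneg_Reals_iff)
    ultimately show "\<exists>d h. 0 < d \<and> summable h \<and> range h \<subseteq> \<real>\<^sub>\<ge>\<^sub>0 \<and> (\<forall>\<^sub>F n in sequentially. \<forall>y\<in>ball x d \<inter> S. cmod (f n y) \<le> cmod (h n))"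
      using d(1) by blast
  qed
  then obtain g g' where g: "\<And>x. x \<in> S \<Longrightarrow> ((\<lambda>n. f n x) sums g x) \<and> ((\<lambda>n. f' n x) sums g' x) \<and> (g has_field_derivative g' x) (at x)"
    by blast
  have s: "s \<in> S" using assms by (simp add: S_def)
  have zg: "zeta_series x = g x" if "x \<in> S" for x
    using g[OF that] by (simp add: sums_iff zeta_series_def f_def)
  have "(g has_field_derivative g' s) (at s)" "g' s = (\<Sum>n. f' n s)" using g[OF s] by (auto simp: sums_iff)
  then have "(zeta_series has_field_derivative (\<Sum>n. f' n s)) (at s)"
    using has_field_derivative_transform_within_open[of g "g' s" s S zeta_series] zg s
    by (auto simp: S_def open_halfspace_Re_gt)
  then show ?thesis by (simp add: f'_def)
qed

lemma has_sum_product_Sigma: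
  fixes f :: "'a \<Rightarrow> complex" and g :: "'b \<Rightarrow> complex"
  assumes "(f has_sum F) A" "(g has_sum G) B" "(\<lambda>x. norm (f x)) summable_on A" "(\<lambda>x. norm (g x)) summable_on B"
  shows "((\<lambda>(a, b). f a * g b) has_sum (F * G)) (A \<times> B)"
proof (rule has_sum_SigmaI)
  show "((\<lambda>y. case (x, y) of (a, b) \<Rightarrow> f a * g b) has_sum f x * G) B" for x
    using assms by (auto intro!: has_sum_cmult_right)
  show "((\<lambda>x. f x * G) has_sum F * G) A"
    using assms by (auto intro!: has_sum_cmult_left)
  have "(\<lambda>x. norm ((\<lambda>(a, b). f a * g b) x)) summable_on A \<times> B"
    unfolding Infinite_Sum.abs_summable_on_Sigma_iff using assms
    by (auto simp: norm_mult infsum_cmult_right' infsum_nonneg intro!: summable_on_cmult_right summable_on_cmult_left)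
  then show "(\<lambda>(a, b). f a * g b) summable_on A \<times> B"
    by (rule abs_summable_summable)
qed

text \<open>
  Absolute convergence allows the double sum over all pairs to be grouped by the value of the
  product.
\<close>
lemma dirichlet_product_sums:
  fixes f g :: "nat \<Rightarrow> complex"
  assumes f: "summable (\<lambda>n. norm (f n))" and g: "summable (\<lambda>n. norm (g n))" and 0: "f 0 = 0" "g 0 = 0"
  shows "(\<lambda>n. if n = 0 then 0 else \<Sum>d | d dvd n. f d * g (n div d)) sums (suminf f * suminf g)"
proof -
  have hs: "(h has_sum suminf h) {1..} \<and> (\<lambda>x. norm (h x)) summable_on {1..}" if h: "summable (\<lambda>n. norm (h n))" "h 0 = 0" for h :: "nat \<Rightarrow> complex"
  proof
    have "(h has_sum suminf h) UNIV"
      by (rule norm_summable_imp_has_sum[OF h(1) summable_sums[OF summable_norm_cancel[OF h(1)]]])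
    moreover have "h x = 0" if "x \<in> UNIV - {1..}" for x
      using that h(2) by (cases x) auto
    ultimately show "(h has_sum suminf h) {1..}"
      by (subst has_sum_cong_neutral[where T = UNIV and g = h]) auto
    show "(\<lambda>x. norm (h x)) summable_on {1..}"
      using norm_summable_imp_summable_on[of "\<lambda>n. norm (h n)"] h by (auto intro: summable_on_subset_banach)
  qed
  have "((\<lambda>(a, b). f a * g b) has_sum (suminf f * suminf g)) ({1..} \<times> {1..})"
    using hs[OF f 0(1)] hs[OF g 0(2)] by (intro has_sum_product_Sigma) auto
  also have "?this \<longleftrightarrow> ((\<lambda>(n, d). f d * g (n div d)) has_sum (suminf f * suminf g)) (Sigma {1..} (\<lambda>n. {d. d dvd n}))"
    by (rule has_sum_reindex_bij_witness[where j = "\<lambda>(a, b). (a * b, a)" and i = "\<lambda>(n, d). (d, n div d)"])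
       (auto simp: Suc_le_eq dvd_div_eq_0_iff intro: Nat.gr0I)
  finally have "((\<lambda>n. \<Sum>d | d dvd n. f d * g (n div d)) has_sum (suminf f * suminf g)) {1..}"
    by (rule has_sum_SigmaD) (auto intro!: has_sum_finiteI)
  moreover have "x = 0" if "\<not> Suc 0 \<le> x" for x using that by simp
  ultimately have "((\<lambda>n. if n = 0 then 0 else \<Sum>d | d dvd n. f d * g (n div d)) has_sum (suminf f * suminf g)) UNIV"
    by (subst has_sum_cong_neutral[where T = "{1..}" and g = "\<lambda>n. \<Sum>d | d dvd n. f d * g (n div d)"]) auto
  then show ?thesis by (rule has_sum_imp_sums)
qed

text \<open>
  The identity \<open>(\<Sum>d | d dvd n. \<Lambda> d) = ln n\<close> in terms of Dirichlet series; the right-hand side is \<open>- \<zeta>'(s)\<close>.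
\<close>
lemma mangoldt_zeta_product:
  assumes "Re s > 1"
  shows "mangoldt_series s * zeta_series s = (\<Sum>n. of_real (ln (real n)) * of_nat n powr (- s))"
proof -
  have s: "summable (\<lambda>n. norm (mangoldt n * of_nat n powr (- s) :: complex))"
    using summable_mangoldt_powr[OF assms] by (simp add: norm_mangoldt_powr)
  have eq: "(if n = 0 then 0 else \<Sum>d | d dvd n. (mangoldt d * of_nat d powr (- s)) * of_nat (n div d) powr (- s))
      = of_real (ln (real n)) * (of_nat n powr (- s) :: complex)" for n :: nat
  proof (cases "n = 0")
    case False
    have "(mangoldt d * of_nat d powr (- s)) * of_nat (n div d) powr (- s) = mangoldt d * (of_nat n powr (- s) :: complex)"
      if "d dvd n" for d
    proof -
      have "of_nat n powr (- s) = (of_nat d * of_nat (n div d) :: complex) powr (- s)"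
        using that by (simp flip: of_nat_mult)
      also have "\<dots> = of_nat d powr (- s) * of_nat (n div d) powr (- s)"
        by (intro powr_times_real) auto
      finally show ?thesis by simp
    qed
    then have "(\<Sum>d | d dvd n. (mangoldt d * of_nat d powr (- s)) * of_nat (n div d) powr (- s))
        = (\<Sum>d | d dvd n. mangoldt d * (of_nat n powr (- s) :: complex))"
      by (intro sum.cong) simp_all
    then show ?thesis
      using False mangoldt_sum[of n, where ?'a = complex] by (simp flip: sum_distrib_right)
  qed simp
  have "(\<lambda>n. of_real (ln (real n)) * (of_nat n powr (- s) :: complex)) sums (mangoldt_series s * zeta_series s)"
    unfolding mangoldt_series_def zeta_series_def eq[symmetric]
    by (rule dirichlet_product_sums[OF s summable_nat_powr[OF assms]]) auto
  then show ?thesis by (simp add: sums_iff)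
qed

section \<open>Zeta has no zero with real part at least 1\<close>

lemma order_of_zero_via_log_deriv:
  fixes f :: "complex \<Rightarrow> complex"
  assumes f: "f holomorphic_on S" and S: "open S" "connected S" "\<xi> \<in> S" and nc: "\<not> f constant_on S"
  obtains k :: nat where "k = 0 \<longleftrightarrow> f \<xi> \<noteq> 0"
    "((\<lambda>z. (z - \<xi>) * (deriv f z / f z)) \<longlongrightarrow> of_nat k) (at \<xi>)" "\<forall>\<^sub>F z in at \<xi>. f z \<noteq> 0"
proof (cases "f \<xi> = 0")
  case False
  have cf: "isCont f \<xi>" "isCont (deriv f) \<xi>"
    using holomorphic_on_imp_continuous_on[OF f] holomorphic_on_imp_continuous_on[OF holomorphic_deriv[OF f S(1)]] S
    by (auto simp: continuous_on_eq_continuous_at)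
  have "((\<lambda>z. (z - \<xi>) * (deriv f z / f z)) \<longlongrightarrow> (\<xi> - \<xi>) * (deriv f \<xi> / f \<xi>)) (at \<xi>)"
    using cf False by (intro tendsto_intros) (auto simp: isCont_def)
  moreover have "\<forall>\<^sub>F z in at \<xi>. f z \<noteq> 0"
    using cf(1) False by (intro tendsto_imp_eventually_ne) (auto simp: isCont_def)
  ultimately show thesis using False by (intro that[of 0]) auto
next
  case True
  obtain g r n where g: "0 < n" "0 < r" "ball \<xi> r \<subseteq> S" "g holomorphic_on ball \<xi> r"
    "\<And>w. w \<in> ball \<xi> r \<Longrightarrow> f w = (w - \<xi>) ^ n * g w" "\<And>w. w \<in> ball \<xi> r \<Longrightarrow> g w \<noteq> 0"
    using holomorphic_factor_zero_nonconstant[OF f S True nc] by metis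
  have cg: "isCont g \<xi>" "isCont (deriv g) \<xi>"
    using holomorphic_on_imp_continuous_on[OF g(4)] holomorphic_on_imp_continuous_on[OF holomorphic_deriv[OF g(4)]] g(2)
    by (auto simp: continuous_on_eq_continuous_at)
  have ev: "\<forall>\<^sub>F z in at \<xi>. z \<in> ball \<xi> r \<and> z \<noteq> \<xi>"
    using g(2) by (auto simp: eventually_at dist_commute intro!: exI[of _ r])
  have "((\<lambda>z. of_nat n + (z - \<xi>) * (deriv g z / g z)) \<longlongrightarrow> of_nat n + (\<xi> - \<xi>) * (deriv g \<xi> / g \<xi>)) (at \<xi>)"
    using cg g(2,6) by (intro tendsto_intros) (auto simp: isCont_def)
  moreover have "\<forall>\<^sub>F z in at \<xi>. of_nat n + (z - \<xi>) * (deriv g z / g z) = (z - \<xi>) * (deriv f z / f z)"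
    using ev
  proof eventually_elim
    case (elim z)
    have z: "z \<in> ball \<xi> r" "z \<noteq> \<xi>" using elim by auto
    have "((\<lambda>w. (w - \<xi>) ^ n * g w) has_field_derivative
        (of_nat n * (z - \<xi>) ^ (n - 1) * g z + (z - \<xi>) ^ n * deriv g z)) (at z)"
      using z holomorphic_derivI[OF g(4) open_ball z(1)]
      by (auto intro!: derivative_eq_intros)
    then have "(f has_field_derivative (of_nat n * (z - \<xi>) ^ (n - 1) * g z + (z - \<xi>) ^ n * deriv g z)) (at z)"
      by (rule has_field_derivative_transform_within_open[OF _ open_ball z(1)]) (simp add: g(5))
    then have d: "deriv f z = of_nat n * (z - \<xi>) ^ (n - 1) * g z + (z - \<xi>) ^ n * deriv g z"
      by (rule DERIV_imp_deriv)
    have "(z - \<xi>) * deriv f z = (of_nat n + (z - \<xi>) * (deriv g z / g z)) * ((z - \<xi>) ^ n * g z)"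
      using g(1) g(6)[OF z(1)] unfolding d by (cases n) (simp_all add: field_simps)
    then show ?case using g(5)[OF z(1)] g(6)[OF z(1)] z(2) by (simp add: field_simps)
  qed
  ultimately have "((\<lambda>z. (z - \<xi>) * (deriv f z / f z)) \<longlongrightarrow> of_nat n) (at \<xi>)"
    by (auto dest: Lim_transform_eventually)
  moreover have "\<forall>\<^sub>F z in at \<xi>. f z \<noteq> 0"
    using ev g(5,6) by (auto elim!: eventually_mono)
  ultimately show thesis using True g(1) by (intro that[of n]) auto
qed

lemma deriv_zeta_regularized:
  assumes s: "Re s > 1"
  shows "deriv zeta_regularized s = zeta_regularized s * (1 / (s - 1) - mangoldt_series s)"
proof -
  define D where "D = (\<Sum>n. - of_real (ln (real n)) * of_nat n powr (- s) :: complex)"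
  have D: "D = - (mangoldt_series s * zeta_series s)"
  proof -
    have "norm (of_real (ln (real n)) * of_nat n powr (- s) :: complex) = ln (real n) * real n powr (- Re s)" for n
      by (cases "n = 0") (simp_all add: norm_mult norm_nat_powr)
    then have "summable (\<lambda>n. norm (of_real (ln (real n)) * of_nat n powr (- s) :: complex))"
      using summable_ln_powr[OF s] by simp
    then have "summable (\<lambda>n. of_real (ln (real n)) * of_nat n powr (- s) :: complex)"
      by (rule summable_norm_cancel)
    then show ?thesis
      unfolding mangoldt_zeta_product[OF s] D_def by (simp add: suminf_minus)
  qed
  have "((\<lambda>s. (s - 1) * zeta_series s) has_field_derivative zeta_series s + (s - 1) * D) (at s)"
    using zeta_series_deriv[OF s] unfolding D_def by (auto intro!: derivative_eq_intros)
  then have "(zeta_regularized has_field_derivative zeta_series s + (s - 1) * D) (at s)"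
    by (rule has_field_derivative_transform_within_open[where S = "{s. Re s > 1}"])
       (use s in \<open>auto simp: zeta_regularized_eq open_halfspace_Re_gt\<close>)
  then have "deriv zeta_regularized s = zeta_series s + (s - 1) * D" by (rule DERIV_imp_deriv)
  also have "\<dots> = (s - 1) * zeta_series s * (1 / (s - 1) - mangoldt_series s)"
  proof -
    have "s - 1 \<noteq> 0" using s by auto
    then show ?thesis unfolding D by (simp add: right_diff_distrib)
  qed
  finally show ?thesis by (simp only: zeta_regularized_eq[OF s])
qed

lemma norm_mangoldt_series_le:
  assumes "Re s \<ge> x" "x > 1"
  shows "norm (mangoldt_series s) \<le> (\<Sum>n. mangoldt n * real n powr (- x))"
proof -
  have "norm (mangoldt_series s) \<le> (\<Sum>n. norm (mangoldt n * of_nat n powr (- s) :: complex))"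
    unfolding mangoldt_series_def
    using assms summable_mangoldt_powr[of "Re s"] by (intro summable_norm) (simp add: norm_mangoldt_powr)
  also have "\<dots> = (\<Sum>n. mangoldt n * real n powr (- Re s))" by (simp add: norm_mangoldt_powr)
  also have "\<dots> \<le> (\<Sum>n. mangoldt n * real n powr (- x))"
  proof (intro suminf_le summable_mangoldt_powr)
    show "mangoldt n * real n powr (- Re s) \<le> mangoldt n * real n powr (- x)" for n
      using assms by (cases "n = 0") (auto intro!: mult_left_mono powr_mono mangoldt_nonneg)
  qed (use assms in auto)
  finally show ?thesis .
qed

text \<open>
  For \<open>Re s > 1\<close> the logarithmic derivative of \<open>(s - 1) \<zeta>(s)\<close> is \<open>1 / (s - 1)\<close> minus the von Mangoldt series.
  Approaching \<open>s\<close> horizontally from the right therefore reads off the order of a zero from the growth of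
  that series.  A zero somewhere, together with the value \<open>1\<close> at \<open>1\<close>, excludes a constant function.
\<close>
lemma zeta_regularized_order:
  assumes s: "Re s \<ge> 1" and zero: "\<exists>z. Re z > 0 \<and> zeta_regularized z = 0"
  obtains k :: nat where "k = 0 \<longleftrightarrow> zeta_regularized s \<noteq> 0"
    "((\<lambda>x::real. of_real x * (1 / (s + of_real x - 1) - mangoldt_series (s + of_real x))) \<longlongrightarrow> of_nat k) (at_right 0)"
proof -
  let ?S = "{s. Re s > 0}"
  have nc: "\<not> zeta_regularized constant_on ?S"
  proof
    assume "zeta_regularized constant_on ?S"
    then obtain c where c: "\<And>z. Re z > 0 \<Longrightarrow> zeta_regularized z = c" by (auto simp: constant_on_def)
    from zero obtain z where z: "Re z > 0" "zeta_regularized z = 0" by blast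
    have "c = 0" using c[OF z(1)] z(2) by simp
    moreover have "c = 1" using c[of 1] by simp
    ultimately show False by simp
  qed
  obtain k :: nat where k: "k = 0 \<longleftrightarrow> zeta_regularized s \<noteq> 0"
    "((\<lambda>z. (z - s) * (deriv zeta_regularized z / zeta_regularized z)) \<longlongrightarrow> of_nat k) (at s)" "\<forall>\<^sub>F z in at s. zeta_regularized z \<noteq> 0"
  proof (rule order_of_zero_via_log_deriv[OF holomorphic_zeta_regularized _ _ _ nc])
    show "open ?S" "connected ?S" "s \<in> ?S"
      using s by (auto simp: open_halfspace_Re_gt convex_connected convex_halfspace_Re_gt)
  qed
  have ev0: "\<forall>\<^sub>F x in at_right (0::real). x > 0" by (simp add: eventually_at_right_less)
  have "((\<lambda>x. s + of_real x) \<longlongrightarrow> s + of_real 0) (at_right (0::real))"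
    by (intro tendsto_intros)
  moreover have "\<forall>\<^sub>F x in at_right (0::real). s + of_real x \<noteq> s"
    using ev0 by eventually_elim auto
  ultimately have lim: "filterlim (\<lambda>x::real. s + of_real x) (at s) (at_right 0)"
    by (simp add: filterlim_at)
  have "((\<lambda>x::real. (s + of_real x - s) * (deriv zeta_regularized (s + of_real x) / zeta_regularized (s + of_real x))) \<longlongrightarrow> of_nat k) (at_right 0)"
    by (rule filterlim_compose[OF k(2) lim])
  moreover have "\<forall>\<^sub>F x in at_right (0::real). (s + of_real x - s) * (deriv zeta_regularized (s + of_real x) / zeta_regularized (s + of_real x))
      = of_real x * (1 / (s + of_real x - 1) - mangoldt_series (s + of_real x))"
    using ev0 eventually_compose_filterlim[OF k(3) lim]
  proof eventually_elim
    case (elim x)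
    have "Re (s + of_real x) > 1" using elim s by simp
    from deriv_zeta_regularized[OF this] elim show ?case by simp
  qed
  ultimately have "((\<lambda>x::real. of_real x * (1 / (s + of_real x - 1) - mangoldt_series (s + of_real x))) \<longlongrightarrow> of_nat k) (at_right 0)"
    by (rule Lim_transform_eventually)
  from that[OF k(1) this] show thesis .
qed

text \<open>
  Near a point with \<open>Re s > 1\<close> the von Mangoldt series stays bounded, so the order of vanishing there is \<open>0\<close>.
\<close>
lemma zeta_regularized_nonzero_right:
  assumes s: "Re s > 1"
  shows "zeta_regularized s \<noteq> 0"
proof
  assume zero: "zeta_regularized s = 0"
  obtain k :: nat where k: "k = 0 \<longleftrightarrow> zeta_regularized s \<noteq> 0"
    "((\<lambda>x::real. of_real x * (1 / (s + of_real x - 1) - mangoldt_series (s + of_real x))) \<longlongrightarrow> of_nat k) (at_right 0)"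
  proof (rule zeta_regularized_order)
    show "\<exists>z. Re z > 0 \<and> zeta_regularized z = 0" using zero s by (intro exI[of _ s]) auto
    show "Re s \<ge> 1" using s by simp
  qed
  define C where "C = (\<Sum>n. mangoldt n * real n powr (- Re s))"
  have s1: "s \<noteq> 1" using s by auto
  have a: "((\<lambda>x::real. of_real x * (1 / (s + of_real x - 1))) \<longlongrightarrow> of_real 0 * (1 / (s + of_real 0 - 1))) (at_right 0)"
    using s1 by (intro tendsto_intros) auto
  have ev: "\<forall>\<^sub>F x in at_right (0::real). norm (of_real x * mangoldt_series (s + of_real x)) \<le> x * C"
    using eventually_at_right_less[of 0]
  proof eventually_elim
    case (elim x)
    then show ?case unfolding C_def norm_mult using s
      by (intro mult_mono norm_mangoldt_series_le) auto
  qed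
  have "((\<lambda>x::real. x * C) \<longlongrightarrow> 0 * C) (at_right 0)" by (intro tendsto_intros)
  then have b: "((\<lambda>x::real. of_real x * mangoldt_series (s + of_real x)) \<longlongrightarrow> 0) (at_right 0)"
    using Lim_null_comparison[OF ev] by simp
  have "((\<lambda>x::real. of_real x * (1 / (s + of_real x - 1) - mangoldt_series (s + of_real x))) \<longlongrightarrow> 0 - 0) (at_right 0)"
    using tendsto_diff[OF a b] by (simp add: right_diff_distrib)
  with k(2) have "of_nat k = (0 :: complex)"
    by (intro tendsto_unique[OF _ k(2)]) auto
  with k(1) zero show False by simp
qed

text \<open>
  Termwise, the sum is a nonnegative multiple of \<open>3 + 4 cos u + cos (2 u) = 2 (1 + cos u)\<^sup>2\<close>.
\<close>
lemma mangoldt_series_3_4_1: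
  fixes \<sigma> t :: real
  assumes "\<sigma> > 1"
  shows "0 \<le> Re (3 * mangoldt_series (of_real \<sigma>) + 4 * mangoldt_series (of_real \<sigma> + \<i> * of_real t)
                 + mangoldt_series (of_real \<sigma> + \<i> * of_real (2 * t)))"
proof -
  define a where "a u n = (mangoldt n * of_nat n powr (- (of_real \<sigma> + \<i> * of_real u)) :: complex)" for u n
  have sums: "a u sums mangoldt_series (of_real \<sigma> + \<i> * of_real u)" for u
  proof -
    have "summable (\<lambda>n. norm (a u n))"
      unfolding a_def norm_mangoldt_powr using summable_mangoldt_powr[OF assms] by simp
    then have "a u sums suminf (a u)" by (rule summable_sums[OF summable_norm_cancel])
    then show ?thesis unfolding mangoldt_series_def a_def .
  qed
  have Re_a: "Re (a u n) = mangoldt n * real n powr (- \<sigma>) * cos (u * ln n)" for u n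
  proof (cases "n = 0")
    case False
    have "of_nat n powr (- (of_real \<sigma> + \<i> * of_real u)) = exp (- (of_real \<sigma> + \<i> * of_real u) * of_real (ln n))"
      using False by (simp add: powr_def Ln_of_nat)
    also have "Re \<dots> = real n powr (- \<sigma>) * cos (u * ln n)"
      using False by (simp add: Re_exp powr_def)
    finally have r: "Re (of_nat n powr (- (of_real \<sigma> + \<i> * of_real u))) = real n powr (- \<sigma>) * cos (u * ln n)" .
    have "a u n = of_real (mangoldt n) * of_nat n powr (- (of_real \<sigma> + \<i> * of_real u))"
      by (simp add: a_def)
    then show ?thesis using r by (simp del: of_real_mangoldt)
  qed (simp add: a_def)
  have "(\<lambda>n. 3 * a 0 n + 4 * a t n + a (2 * t) n) sums (3 * mangoldt_series (of_real \<sigma> + \<i> * of_real 0)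
     + 4 * mangoldt_series (of_real \<sigma> + \<i> * of_real t) + mangoldt_series (of_real \<sigma> + \<i> * of_real (2 * t)))"
    by (intro sums_add sums_mult sums)
  then have re_sums: "(\<lambda>n. Re (3 * a 0 n + 4 * a t n + a (2 * t) n)) sums Re (3 * mangoldt_series (of_real \<sigma> + \<i> * of_real 0)
     + 4 * mangoldt_series (of_real \<sigma> + \<i> * of_real t) + mangoldt_series (of_real \<sigma> + \<i> * of_real (2 * t)))"
    by (rule sums_Re)
  have nonneg: "0 \<le> Re (3 * a 0 n + 4 * a t n + a (2 * t) n)" for n
  proof -
    have "Re (3 * a 0 n + 4 * a t n + a (2 * t) n)
        = mangoldt n * real n powr (- \<sigma>) * (3 + 4 * cos (t * ln n) + cos (2 * (t * ln n)))"
      by (simp add: Re_a algebra_simps)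
    also have "3 + 4 * cos (t * ln n) + cos (2 * (t * ln n)) = 2 * (1 + cos (t * ln n))\<^sup>2"
      unfolding cos_double_cos by (simp add: power2_eq_square algebra_simps)
    also have "mangoldt n * real n powr (- \<sigma>) * (2 * (1 + cos (t * ln n))\<^sup>2) \<ge> 0"
      by (intro mult_nonneg_nonneg mangoldt_nonneg) auto
    finally show ?thesis .
  qed
  from sums_le[OF nonneg sums_zero re_sums] show ?thesis by simp
qed

text \<open>
  If \<open>1 + \<i> t\<close> were a zero of order \<open>k > 0\<close> and \<open>1 + 2 \<i> t\<close> one of order \<open>m \<ge> 0\<close>, then multiplying the preceding
  inequality by \<open>x = \<sigma> - 1\<close> and letting \<open>x\<close> tend to \<open>0\<close> would give \<open>3 - 4 k - m \<ge> 0\<close>.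
\<close>
theorem zeta_regularized_nonzero:
  assumes s: "Re s \<ge> 1"
  shows "zeta_regularized s \<noteq> 0"
proof
  assume zero: "zeta_regularized s = 0"
  define t where "t = Im s"
  have ex: "\<exists>z. Re z > 0 \<and> zeta_regularized z = 0" using zero s by (intro exI[of _ s]) auto
  have Re1: "Re s = 1" using zeta_regularized_nonzero_right[of s] zero s by force
  then have s_eq: "s = 1 + \<i> * of_real t" by (simp add: t_def complex_eq_iff)
  have t: "t \<noteq> 0" using zero by (auto simp: s_eq)
  define M where "M u x = of_real x * mangoldt_series (1 + of_real x + \<i> * of_real u)" for u x :: real
  have limM: "\<exists>k::nat. (k = 0 \<longleftrightarrow> zeta_regularized (1 + \<i> * of_real u) \<noteq> 0) \<and> (M u \<longlongrightarrow> - of_nat k) (at_right 0)" if u: "u \<noteq> 0" for u :: real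
  proof -
    define s' where "s' = 1 + \<i> * of_real u"
    have re: "Re s' \<ge> 1" by (simp add: s'_def)
    obtain k :: nat where k: "k = 0 \<longleftrightarrow> zeta_regularized s' \<noteq> 0"
      "((\<lambda>x::real. of_real x * (1 / (s' + of_real x - 1) - mangoldt_series (s' + of_real x))) \<longlongrightarrow> of_nat k) (at_right 0)"
      by (rule zeta_regularized_order[OF re ex])
    have "((\<lambda>x::real. of_real x * (1 / (s' + of_real x - 1))) \<longlongrightarrow> of_real 0 * (1 / (s' + of_real 0 - 1))) (at_right 0)"
      using u by (intro tendsto_intros) (auto simp: s'_def)
    from tendsto_diff[OF this k(2)]
    have M: "(M u \<longlongrightarrow> - of_nat k) (at_right 0)"
      by (simp add: right_diff_distrib M_def[abs_def] s'_def add_ac)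
    show ?thesis using k(1) M unfolding s'_def by (intro exI[of _ k] conjI)
  qed
  obtain k :: nat where k: "k \<noteq> 0" "(M t \<longlongrightarrow> - of_nat k) (at_right 0)"
    using limM[OF t] zero unfolding s_eq by blast
  obtain m :: nat where m: "(M (2 * t) \<longlongrightarrow> - of_nat m) (at_right 0)"
  proof -
    have "2 * t \<noteq> 0" using t by simp
    from limM[OF this] that show thesis by blast
  qed
  have M0: "(M 0 \<longlongrightarrow> 1) (at_right 0)"
  proof -
    have re: "Re 1 \<ge> (1 :: real)" by simp
    obtain k :: nat where k: "k = 0 \<longleftrightarrow> zeta_regularized 1 \<noteq> 0"
      "((\<lambda>x::real. of_real x * (1 / (1 + of_real x - 1) - mangoldt_series (1 + of_real x))) \<longlongrightarrow> of_nat k) (at_right 0)"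
      by (rule zeta_regularized_order[OF re ex])
    from k(1) have "k = 0" by simp
    with k(2) have lim: "((\<lambda>x::real. of_real x * (1 / (1 + of_real x - 1) - mangoldt_series (1 + of_real x))) \<longlongrightarrow> 0) (at_right 0)"
      by simp
    have lim': "((\<lambda>x::real. 1 - of_real x * (1 / (1 + of_real x - 1) - mangoldt_series (1 + of_real x))) \<longlongrightarrow> 1 - 0) (at_right 0)"
      by (rule tendsto_diff[OF tendsto_const lim])
    have ev: "\<forall>\<^sub>F x::real in at_right 0. 1 - of_real x * (1 / (1 + of_real x - 1) - mangoldt_series (1 + of_real x)) = M 0 x"
      using eventually_at_right_less[of 0] by eventually_elim (simp add: M_def right_diff_distrib)
    show ?thesis using Lim_transform_eventually[OF lim' ev] by simp
  qed
  have "((\<lambda>x. Re (3 * M 0 x + 4 * M t x + M (2 * t) x)) \<longlongrightarrow> Re (3 * 1 + 4 * (- of_nat k) + (- of_nat m))) (at_right 0)"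
    by (intro tendsto_intros M0 k m)
  moreover have "\<forall>\<^sub>F x in at_right 0. 0 \<le> Re (3 * M 0 x + 4 * M t x + M (2 * t) x)"
    using eventually_at_right_less[of 0]
  proof eventually_elim
    case (elim x)
    have "3 * M 0 x + 4 * M t x + M (2 * t) x = of_real x * (3 * mangoldt_series (of_real (1 + x)) + 4 * mangoldt_series (of_real (1 + x) + \<i> * of_real t)
                 + mangoldt_series (of_real (1 + x) + \<i> * of_real (2 * t)))"
      by (simp add: M_def distrib_left mult.left_commute)
    moreover have "0 \<le> x * Re (3 * mangoldt_series (of_real (1 + x)) + 4 * mangoldt_series (of_real (1 + x) + \<i> * of_real t)
                 + mangoldt_series (of_real (1 + x) + \<i> * of_real (2 * t)))"
      by (rule mult_nonneg_nonneg[OF less_imp_le[OF elim] mangoldt_series_3_4_1]) (use elim in simp)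
    moreover have "Re (of_real x * z) = x * Re z" for z by simp
    ultimately show ?case by (simp only:)
  qed
  ultimately have "0 \<le> Re (3 * 1 + 4 * (- of_nat k) + (- of_nat m))"
    by (rule tendsto_lowerbound) auto
  then show False using k(1) by simp
qed

section \<open>Chebyshev's function and its linear upper bound\<close>

definition chebyshev_psi :: "nat \<Rightarrow> real" where
  "chebyshev_psi n = (\<Sum>k\<le>n. mangoldt k)"

lemma chebyshev_psi_0 [simp]: "chebyshev_psi 0 = 0"
  by (simp add: chebyshev_psi_def)

lemma chebyshev_psi_Suc: "chebyshev_psi (Suc n) = chebyshev_psi n + mangoldt (Suc n)"
  by (simp add: chebyshev_psi_def)

lemma chebyshev_psi_mono: "m \<le> n \<Longrightarrow> chebyshev_psi m \<le> chebyshev_psi n"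
  unfolding chebyshev_psi_def by (intro sum_mono2) (auto simp: mangoldt_nonneg)

lemma chebyshev_psi_nonneg: "0 \<le> chebyshev_psi n"
  unfolding chebyshev_psi_def by (intro sum_nonneg mangoldt_nonneg)

text \<open>
  Passing from \<open>n\<close> to \<open>n + 1\<close> increases \<open>n div d\<close> exactly for the divisors \<open>d\<close> of \<open>n + 1\<close>.  The free upper
  limit \<open>N\<close> lets the expansions for \<open>n\<close> and \<open>2 n\<close> be compared term by term.
\<close>
lemma ln_fact_eq_sum_mangoldt:
  assumes "n \<le> N"
  shows "ln (fact n :: real) = (\<Sum>d=1..N. mangoldt d * real (n div d))"
  using assms
proof (induction n)
  case (Suc n)
  have "real (Suc n div d) = real (n div d) + (if d dvd Suc n then 1 else 0)" if "d \<in> {1..N}" for d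
    by (simp add: div_Suc dvd_eq_mod_eq_0)
  then have "(\<Sum>d=1..N. mangoldt d * real (Suc n div d))
      = (\<Sum>d=1..N. mangoldt d * real (n div d) + (if d dvd Suc n then mangoldt d else 0))"
    by (intro sum.cong) (auto simp: distrib_left)
  also have "\<dots> = ln (fact n) + (\<Sum>d=1..N. if d dvd Suc n then mangoldt d else 0)"
    using Suc by (simp add: sum.distrib)
  also have "(\<Sum>d=1..N. if d dvd Suc n then mangoldt d else 0) = (\<Sum>d | d dvd Suc n. mangoldt d :: real)"
  proof (intro sum.mono_neutral_cong_right)
    have "0 < d \<and> d \<le> N" if "d dvd Suc n" for d
      using dvd_imp_le[OF that] dvd_pos_nat[OF _ that] Suc.prems by simp
    then show "{d. d dvd Suc n} \<subseteq> {1..N}" by (auto simp: Suc_le_eq)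
  qed auto
  also have "\<dots> = ln (real (Suc n))" using mangoldt_sum[of "Suc n", where ?'a = real] by simp
  also have "ln (fact n) + ln (real (Suc n)) = ln (fact (Suc n) :: real)"
    by (simp add: ln_mult del: of_nat_Suc)
  finally show ?case ..
qed simp

text \<open>
  In the expansion of the logarithm of the central binomial coefficient all weights are nonnegative, and
  those of \<open>d\<close> with \<open>n < d \<le> 2 n\<close> are \<open>1\<close>.
\<close>
lemma chebyshev_psi_double: "chebyshev_psi (2 * n) - chebyshev_psi n \<le> 2 * real n * ln 2"
proof -
  have "chebyshev_psi (2 * n) - chebyshev_psi n = (\<Sum>d\<in>{..2 * n} - {..n}. mangoldt d)"
    unfolding chebyshev_psi_def by (subst sum_diff) auto
  also have "{..2 * n} - {..n} = {n<..2 * n}" by auto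
  also have "(\<Sum>d\<in>{n<..2 * n}. mangoldt d) = (\<Sum>d\<in>{n<..2 * n}. mangoldt d * (real (2 * n div d) - 2 * real (n div d)))"
  proof (intro sum.cong refl)
    fix d assume d: "d \<in> {n<..2 * n}"
    then have "2 * n div d = 1" "n div d = 0" by (auto intro: div_nat_eqI)
    then show "mangoldt d = mangoldt d * (real (2 * n div d) - 2 * real (n div d))" by simp
  qed
  also have "\<dots> \<le> (\<Sum>d=1..2 * n. mangoldt d * (real (2 * n div d) - 2 * real (n div d)))"
  proof (intro sum_mono2)
    fix d
    have "2 * (n div d) \<le> 2 * n div d"
      using div_times_less_eq_dividend[of n d]
      by (cases "d = 0") (auto simp: less_eq_div_iff_mult_less_eq)
    then have "2 * real (n div d) \<le> real (2 * n div d)" by (metis of_nat_le_iff of_nat_mult of_nat_numeral)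
    then show "0 \<le> mangoldt d * (real (2 * n div d) - 2 * real (n div d))"
      by (intro mult_nonneg_nonneg mangoldt_nonneg) auto
  qed auto
  also have "\<dots> = ln (fact (2 * n)) - 2 * ln (fact n)"
  proof -
    have e: "ln (fact (2 * n) :: real) = (\<Sum>d=1..2 * n. mangoldt d * real (2 * n div d))"
      "ln (fact n :: real) = (\<Sum>d=1..2 * n. mangoldt d * real (n div d))"
      by (rule ln_fact_eq_sum_mangoldt; simp)+
    show ?thesis unfolding e
      by (simp add: right_diff_distrib sum_subtractf sum_distrib_left mult_ac)
  qed
  also have "\<dots> = ln (real (2 * n choose n))"
  proof -
    have "real (fact (2 * n)) = real (fact n) * real (fact n) * real (2 * n choose n)"
      using binomial_fact_lemma[of n "2 * n"] by (metis of_nat_mult diff_add_inverse le_add1 mult_2)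
    moreover have "real (2 * n choose n) > 0" by simp
    ultimately show ?thesis by (simp add: ln_mult)
  qed
  also have "\<dots> \<le> ln (2 ^ (2 * n))"
  proof -
    have "(2 * n choose n) \<le> (\<Sum>k\<le>2 * n. 2 * n choose k)" by (intro member_le_sum) auto
    then have "(2 * n choose n) \<le> 2 ^ (2 * n)" by (simp only: choose_row_sum)
    then have "real (2 * n choose n) \<le> 2 ^ (2 * n)" by (metis of_nat_le_iff of_nat_numeral of_nat_power)
    moreover have "real (2 * n choose n) > 0" by simp
    ultimately show ?thesis by (subst ln_le_cancel_iff) auto
  qed
  also have "\<dots> = 2 * real n * ln 2" by (simp add: ln_realpow)
  finally show ?thesis .
qed

theorem chebyshev_psi_le: "chebyshev_psi n \<le> 4 * real n"
proof (induction n rule: less_induct)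
  case (less n)
  have ln2: "ln 2 \<le> (1 :: real)" using ln_le_minus_one[of 2] by simp
  consider "n = 0" | "n = 1" | "n \<ge> 2" by linarith
  then show ?case
  proof cases
    case 3
    \<comment> \<open>Rounding up keeps \<open>n \<le> 2 m\<close>; then \<open>4 m + 2 m \<le> 4 n\<close> holds from \<open>n = 2\<close> on.\<close>
    define m where "m = (n + 1) div 2"
    have m: "m < n" "n \<le> 2 * m" "2 * m \<le> n + 1" using 3 by (auto simp: m_def)
    have "chebyshev_psi n \<le> chebyshev_psi (2 * m)" using m by (intro chebyshev_psi_mono)
    also have "\<dots> \<le> chebyshev_psi m + 2 * real m * ln 2" using chebyshev_psi_double[of m] by simp
    also have "\<dots> \<le> 4 * real m + 2 * real m * 1" using less[OF m(1)] ln2 by (intro add_mono mult_left_mono) auto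
    also have "\<dots> \<le> 4 * real n" using m 3 by linarith
    finally show ?thesis .
  qed (auto simp: chebyshev_psi_def)
qed


section \<open>Convergence of the series of (psi(k) - k) / k^2\<close>

definition psi_error :: "nat \<Rightarrow> real" where
  "psi_error k = chebyshev_psi k - real k"

lemma psi_error_0 [simp]: "psi_error 0 = 0"
  by (simp add: psi_error_def)

lemma abs_psi_error_le: "\<bar>psi_error k\<bar> \<le> 4 * real k"
  using chebyshev_psi_le[of k] chebyshev_psi_nonneg[of k] by (auto simp: psi_error_def)

lemma powr_difference_mvt:
  fixes x p :: real
  assumes "x > 0"
  obtains \<xi> where "x < \<xi>" "\<xi> < x + 1" "(x + 1) powr p - x powr p = p * \<xi> powr (p - 1)"
proof -
  have "\<exists>z. x < z \<and> z < x + 1 \<and> (x + 1) powr p - x powr p = (x + 1 - x) * (p * z powr (p - 1))"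
    using assms by (intro MVT2 has_real_derivative_powr) auto
  then show thesis using that by auto
qed

lemma powr_sum_tail_le:
  assumes "\<sigma> > 0"
  shows "(\<Sum>k. real (k + Suc n + 1) powr (- 1 - \<sigma>)) \<le> real (Suc n) powr (- \<sigma>) / \<sigma>"
    and "summable (\<lambda>k. real (k + Suc n + 1) powr (- 1 - \<sigma>))"
proof -
  have le: "real (k + Suc n + 1) powr (- 1 - \<sigma>) \<le> (real (k + Suc n) powr (- \<sigma>) - real (Suc k + Suc n) powr (- \<sigma>)) / \<sigma>" for k
  proof -
    obtain \<xi> where \<xi>: "real (k + Suc n) < \<xi>" "\<xi> < real (k + Suc n) + 1"
      "(real (k + Suc n) + 1) powr (- \<sigma>) - real (k + Suc n) powr (- \<sigma>) = - \<sigma> * \<xi> powr (- \<sigma> - 1)"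
      using powr_difference_mvt[of "real (k + Suc n)" "- \<sigma>"] by auto
    have e: "- \<sigma> - 1 = - 1 - \<sigma>" by simp
    have "(real (k + Suc n) + 1) powr (- 1 - \<sigma>) \<le> \<xi> powr (- 1 - \<sigma>)"
      using \<xi>(1,2) assms by (intro powr_mono2') auto
    then have "\<sigma> * (real (k + Suc n) + 1) powr (- 1 - \<sigma>) \<le> \<sigma> * \<xi> powr (- 1 - \<sigma>)"
      using assms by (intro mult_left_mono) auto
    also have "\<dots> = real (k + Suc n) powr (- \<sigma>) - real (Suc k + Suc n) powr (- \<sigma>)"
      using \<xi>(3) unfolding e by (simp add: add_ac)
    finally show ?thesis using assms by (simp add: le_divide_eq mult.commute add_ac)
  qed
  have "(\<lambda>k. real (k + Suc n) powr (- \<sigma>)) \<longlonglongrightarrow> 0"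
    using assms by (intro tendsto_neg_powr filterlim_compose[OF filterlim_real_sequentially filterlim_add_const_nat_at_top]) auto
  from telescope_sums'[OF this] have sums: "(\<lambda>k. (real (k + Suc n) powr (- \<sigma>) - real (Suc k + Suc n) powr (- \<sigma>)) / \<sigma>)
      sums (real (Suc n) powr (- \<sigma>) / \<sigma>)"
    by (intro sums_divide) simp
  show s: "summable (\<lambda>k. real (k + Suc n + 1) powr (- 1 - \<sigma>))"
    by (rule summable_comparison_test'[OF sums_summable[OF sums], of 0]) (use le in auto)
  show "(\<Sum>k. real (k + Suc n + 1) powr (- 1 - \<sigma>)) \<le> real (Suc n) powr (- \<sigma>) / \<sigma>"
    using suminf_le[OF le s sums_summable[OF sums]] sums_unique[OF sums] by simp
qed

text \<open>
  Comparison with the integral of \<open>x\<^bsup>a-1\<^esup>\<close>.  For \<open>a \<ge> 1\<close> the summands increase and the last one has to be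
  added, for \<open>a < 1\<close> they decrease.
\<close>
lemma powr_sum_head_le:
  assumes "a > 0"
  shows "(\<Sum>k=1..Suc n. real k powr (a - 1)) \<le> real (Suc n) powr a * (1 / a + 1 / real (Suc n))"
proof -
  have "(\<Sum>k=1..Suc n. real k powr (a - 1)) \<le> real (Suc n) powr a / a + (if a \<ge> 1 then real (Suc n) powr (a - 1) else 0)"
  proof (induction n)
    case 0
    then show ?case using assms by (simp add: field_simps)
  next
    case (Suc n)
    obtain \<xi> where \<xi>: "real (Suc n) < \<xi>" "\<xi> < real (Suc n) + 1"
      "(real (Suc n) + 1) powr a - real (Suc n) powr a = a * \<xi> powr (a - 1)"
      using powr_difference_mvt[of "real (Suc n)" a] by auto
    have d: "\<xi> powr (a - 1) = real (Suc (Suc n)) powr a / a - real (Suc n) powr a / a"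
      using \<xi>(3) assms by (simp add: field_simps)
    have "(\<Sum>k=1..Suc (Suc n). real k powr (a - 1)) = (\<Sum>k=1..Suc n. real k powr (a - 1)) + real (Suc (Suc n)) powr (a - 1)"
      by simp
    also have "\<dots> \<le> real (Suc (Suc n)) powr a / a + (if a \<ge> 1 then real (Suc (Suc n)) powr (a - 1) else 0)"
    proof (cases "a \<ge> 1")
      case True
      have "real (Suc n) powr (a - 1) \<le> \<xi> powr (a - 1)" using \<xi> True by (intro powr_mono2) auto
      then show ?thesis using Suc True d by simp
    next
      case False
      have "real (Suc (Suc n)) powr (a - 1) \<le> \<xi> powr (a - 1)" using \<xi> False by (intro powr_mono2') auto
      then show ?thesis using Suc False d by simp
    qed
    finally show ?case .
  qed
  also have "\<dots> \<le> real (Suc n) powr a / a + real (Suc n) powr (a - 1)" by simp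
  also have "real (Suc n) powr (a - 1) = real (Suc n) powr a / real (Suc n)" by (simp add: powr_diff)
  finally show ?thesis by (simp add: distrib_left)
qed

text \<open>
  The exponent is shifted so that the point of interest is \<open>z = 0\<close> and the coefficients with respect to
  \<open>k\<^bsup>-1-z\<^esup>\<close> are \<open>(\<psi>(k) - k) / k\<close>, which are bounded by Chebyshev's estimate.
\<close>
definition psi_partial :: "nat \<Rightarrow> complex \<Rightarrow> complex" where
  "psi_partial n z = (\<Sum>k\<le>n. of_real (psi_error k) * of_nat k powr (- 2 - z))"

lemma norm_psi_term_le:
  "norm (of_real (psi_error k) * of_nat k powr (- 2 - z) :: complex) \<le> 4 * real k powr (- 1 - Re z)"
proof -
  have "norm (of_real (psi_error k) * of_nat k powr (- 2 - z) :: complex) = \<bar>psi_error k\<bar> * real k powr (- 2 - Re z)"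
    by (simp add: norm_mult norm_nat_powr)
  also have "\<dots> \<le> (4 * real k) * real k powr (- 2 - Re z)"
    by (intro mult_right_mono abs_psi_error_le) auto
  also have "\<dots> = 4 * real k powr (- 1 - Re z)"
    by (cases "k = 0") (simp_all add: powr_mult_base algebra_simps)
  finally show ?thesis .
qed

lemma psi_partial_left:
  assumes "Re z < 0"
  shows "norm (psi_partial (Suc n) z) \<le> 4 * exp (- ln (real (Suc n)) * Re z) * (1 / \<bar>Re z\<bar> + 1 / real (Suc n))"
proof -
  define a where "a = - Re z"
  have a: "a > 0" using assms by (simp add: a_def)
  have "norm (psi_partial (Suc n) z) \<le> (\<Sum>k\<le>Suc n. 4 * real k powr (- 1 - Re z))"
    unfolding psi_partial_def by (intro sum_norm_le norm_psi_term_le)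
  also have "\<dots> = (\<Sum>k=1..Suc n. 4 * real k powr (- 1 - Re z))"
    by (intro sum.mono_neutral_right) (auto simp: Suc_le_eq)
  also have "\<dots> = 4 * (\<Sum>k=1..Suc n. real k powr (a - 1))"
  proof -
    have "- 1 - Re z = a - 1" by (simp add: a_def)
    then show ?thesis by (simp only: sum_distrib_left)
  qed
  also have "\<dots> \<le> 4 * (real (Suc n) powr a * (1 / a + 1 / real (Suc n)))"
    by (intro mult_left_mono powr_sum_head_le a) auto
  finally show ?thesis using assms by (simp add: a_def powr_def mult_ac)
qed

lemma psi_partial_right:
  assumes z: "Re z > 0"
  shows "summable (\<lambda>k. of_real (psi_error k) * of_nat k powr (- 2 - z) :: complex)"
    and "norm ((\<Sum>k. of_real (psi_error k) * of_nat k powr (- 2 - z)) - psi_partial (Suc n) z)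
         \<le> 4 * exp (- ln (real (Suc n)) * Re z) / Re z"
proof -
  define f where "f k = (of_real (psi_error k) * of_nat k powr (- 2 - z) :: complex)" for k
  have s4: "summable (\<lambda>k. 4 * real k powr (- 1 - Re z))"
    using z by (intro summable_mult) (simp add: summable_real_powr_iff)
  have sf: "summable f"
    by (rule summable_comparison_test'[OF s4, of 0]) (use norm_psi_term_le[of _ z] in \<open>simp add: f_def\<close>)
  then show "summable (\<lambda>k. of_real (psi_error k) * of_nat k powr (- 2 - z) :: complex)"
    by (simp add: f_def[abs_def])
  have st: "summable (\<lambda>k. 4 * real (k + Suc n + 1) powr (- 1 - Re z))"
    by (intro summable_mult powr_sum_tail_le z)
  have "(\<Sum>k. f k) = (\<Sum>k. f (k + (Suc n + 1))) + (\<Sum>k<Suc n + 1. f k)"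
    by (rule suminf_split_initial_segment[OF sf])
  also have "(\<Sum>k<Suc n + 1. f k) = psi_partial (Suc n) z"
    by (simp add: psi_partial_def f_def lessThan_Suc_atMost del: sum.lessThan_Suc)
  finally have "(\<Sum>k. f k) - psi_partial (Suc n) z = (\<Sum>k. f (k + (Suc n + 1)))" by simp
  also have "norm \<dots> \<le> (\<Sum>k. 4 * real (k + Suc n + 1) powr (- 1 - Re z))"
    by (rule norm_suminf_le[OF _ st]) (use norm_psi_term_le[of "_ + (Suc n + 1)" z] in \<open>simp add: f_def add_ac\<close>)
  also have "\<dots> = 4 * (\<Sum>k. real (k + Suc n + 1) powr (- 1 - Re z))"
    by (intro suminf_mult powr_sum_tail_le z)
  also have "\<dots> \<le> 4 * (real (Suc n) powr (- Re z) / Re z)"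
    by (intro mult_left_mono powr_sum_tail_le z) auto
  finally show "norm ((\<Sum>k. of_real (psi_error k) * of_nat k powr (- 2 - z)) - psi_partial (Suc n) z)
         \<le> 4 * exp (- ln (real (Suc n)) * Re z) / Re z"
    by (simp add: f_def powr_def mult_ac)
qed


lemma psi_error_abel_sum:
  fixes x :: "nat \<Rightarrow> complex"
  shows "(\<Sum>k\<le>n. of_real (psi_error k) * (x k - x (Suc k)))
    = (\<Sum>k\<le>n. (mangoldt k - (if k = 0 then 0 else 1)) * x k) - of_real (psi_error n) * x (Suc n)"
proof (induction n)
  case (Suc n)
  have e: "of_real (psi_error (Suc n)) = of_real (psi_error n) + (mangoldt (Suc n) - 1 :: complex)"
    by (simp add: psi_error_def chebyshev_psi_Suc)
  show ?case unfolding sum.atMost_Suc Suc.IH e by (simp add: algebra_simps)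
qed simp

text \<open>
  Summation by parts; the boundary term is \<open>O(n\<^bsup>1 - Re w\<^esup>)\<close>.
\<close>
lemma psi_error_sums:
  assumes w: "Re w > 1"
  shows "(\<lambda>k. of_real (psi_error k) * (of_nat k powr (- w) - of_nat (Suc k) powr (- w)))
           sums (mangoldt_series w - zeta_series w)"
proof -
  define x where "x k = (of_nat k powr (- w) :: complex)" for k :: nat
  have "(\<lambda>k. mangoldt k * x k) sums mangoldt_series w"
  proof -
    have "summable (\<lambda>k. norm (mangoldt k * x k))"
      unfolding x_def norm_mangoldt_powr using summable_mangoldt_powr[OF w] by simp
    from summable_sums[OF summable_norm_cancel[OF this]] show ?thesis
      unfolding mangoldt_series_def x_def .
  qed
  moreover have "x sums zeta_series w"
    using summable_sums[OF summable_norm_cancel[OF summable_nat_powr[OF w]]]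
    unfolding zeta_series_def x_def .
  ultimately have "(\<lambda>k. mangoldt k * x k - x k) sums (mangoldt_series w - zeta_series w)"
    by (rule sums_diff)
  moreover have "mangoldt k * x k - x k = (mangoldt k - (if k = 0 then 0 else 1)) * x k" for k
    by (cases "k = 0") (auto simp: x_def algebra_simps)
  ultimately have "(\<lambda>n. \<Sum>k\<le>n. (mangoldt k - (if k = 0 then 0 else 1)) * x k) \<longlonglongrightarrow> mangoldt_series w - zeta_series w"
    unfolding sums_def_le by simp
  moreover have "(\<lambda>n. of_real (psi_error n) * x (Suc n)) \<longlonglongrightarrow> 0"
  proof (rule Lim_null_comparison)
    show "\<forall>\<^sub>F n in sequentially. norm (of_real (psi_error n) * x (Suc n)) \<le> 4 * real (Suc n) powr (1 - Re w)"
    proof (rule always_eventually, rule allI)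
      fix n
      have "norm (of_real (psi_error n) * x (Suc n)) = \<bar>psi_error n\<bar> * real (Suc n) powr (- Re w)"
        unfolding x_def norm_mult norm_nat_powr by simp
      also have "\<dots> \<le> (4 * real (Suc n)) * real (Suc n) powr (- Re w)"
        using abs_psi_error_le[of n] by (intro mult_right_mono) auto
      also have "\<dots> = 4 * (real (Suc n) * real (Suc n) powr (- Re w))" by (simp only: mult.assoc)
      also have "real (Suc n) * real (Suc n) powr (- Re w) = real (Suc n) powr (1 + - Re w)"
        by (rule powr_mult_base) simp
      also have "1 + - Re w = 1 - Re w" by simp
      finally show "norm (of_real (psi_error n) * x (Suc n)) \<le> 4 * real (Suc n) powr (1 - Re w)" .
    qed
    have "(\<lambda>n. real (Suc n) powr (1 - Re w)) \<longlonglongrightarrow> 0"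
      using w by (intro tendsto_neg_powr filterlim_compose[OF filterlim_real_sequentially filterlim_Suc]) auto
    from tendsto_mult_right_zero[OF this] show "(\<lambda>n. 4 * real (Suc n) powr (1 - Re w)) \<longlonglongrightarrow> 0" .
  qed
  ultimately have "(\<lambda>n. \<Sum>k\<le>n. of_real (psi_error k) * (x k - x (Suc k))) \<longlonglongrightarrow> mangoldt_series w - zeta_series w - 0"
    unfolding psi_error_abel_sum by (rule tendsto_diff)
  then show ?thesis unfolding sums_def_le x_def by simp
qed

definition psi_remainder :: "complex \<Rightarrow> complex" where
  "psi_remainder w = (\<Sum>k. of_real (psi_error k) * powr_remainder k w)"

lemma psi_error_powr_bound: "norm (of_real (psi_error k) :: complex) \<le> 4 * real k powr 1"
  using abs_psi_error_le[of k] by simp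

lemma holomorphic_psi_remainder: "psi_remainder holomorphic_on {w. Re w > 0}"
  using powr_remainder_series(2)[OF psi_error_powr_bound] unfolding psi_remainder_def[abs_def] by simp

text \<open>
  Replacing the differences of \<open>k\<^bsup>-w\<^esup>\<close> in the previous series by derivatives, with \<open>w = 1 + z\<close>.
\<close>
lemma psi_dirichlet_series:
  assumes z: "Re z > 0"
  shows "(1 + z) * (\<Sum>k. of_real (psi_error k) * of_nat k powr (- 2 - z))
    = mangoldt_series (1 + z) - zeta_series (1 + z) - psi_remainder (1 + z)"
proof -
  define w where "w = 1 + z"
  have w: "Re w > 1" using z by (simp add: w_def)
  have "summable (\<lambda>k. of_real (psi_error k) * powr_remainder k w)"
    using powr_remainder_series(1)[OF psi_error_powr_bound, of w] w by simp
  then have "(\<lambda>k. of_real (psi_error k) * powr_remainder k w) sums psi_remainder w"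
    unfolding psi_remainder_def by (rule summable_sums)
  from sums_diff[OF psi_error_sums[OF w] this]
  have "(\<lambda>k. of_real (psi_error k) * (of_nat k powr (- w) - of_nat (Suc k) powr (- w)) - of_real (psi_error k) * powr_remainder k w)
     sums (mangoldt_series w - zeta_series w - psi_remainder w)" .
  moreover have "of_real (psi_error k) * (of_nat k powr (- w) - of_nat (Suc k) powr (- w)) - of_real (psi_error k) * powr_remainder k w
     = w * (of_real (psi_error k) * of_nat k powr (- 2 - z))" for k
  proof (cases "k = 0")
    case False
    have e: "- w - 1 = - 2 - z" by (simp add: w_def)
    show ?thesis using False unfolding powr_remainder_def e by (simp add: right_diff_distrib)
  qed simp
  ultimately have a: "(\<lambda>k. w * (of_real (psi_error k) * of_nat k powr (- 2 - z))) sums (mangoldt_series w - zeta_series w - psi_remainder w)"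
    by (simp only:)
  have b: "(\<lambda>k. w * (of_real (psi_error k) * of_nat k powr (- 2 - z))) sums (w * (\<Sum>k. of_real (psi_error k) * of_nat k powr (- 2 - z)))"
    by (intro sums_mult summable_sums psi_partial_right(1) z)
  from sums_unique2[OF b a] show ?thesis unfolding w_def .
qed

text \<open>
  With \<open>h(w) = (w - 1) \<zeta>(w)\<close> and \<open>h(1) = 1\<close> one has \<open>- \<zeta>'/\<zeta> - \<zeta> = (1 - h(w)) / (w - 1) - h'(w) / h(w)\<close>.
  The first quotient has a removable singularity at \<open>1\<close> and the second is holomorphic near the closed half-plane
  because \<open>h\<close> does not vanish there.
\<close>
lemma psi_dirichlet_series_continuation:
  obtains U g where "open U" "{z. Re z \<ge> 0} \<subseteq> U" "g holomorphic_on U"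
    "\<And>z. Re z > 0 \<Longrightarrow> g z = (\<Sum>k. of_real (psi_error k) * of_nat k powr (- 2 - z))"
proof -
  define H where "H = {w. Re w > 0}"
  define V where "V = {w \<in> H. zeta_regularized w \<noteq> 0}"
  define U where "U = (\<lambda>z. 1 + z) -` V"
  define q where "q w = (if w = 1 then deriv zeta_regularized 1 else (zeta_regularized w - zeta_regularized 1) / (w - 1))" for w
  define F where "F w = - q w - deriv zeta_regularized w / zeta_regularized w - psi_remainder w" for w
  define g where "g z = F (1 + z) / (1 + z)" for z
  have H: "open H" by (simp add: H_def open_halfspace_Re_gt)
  have hol: "zeta_regularized holomorphic_on H" using holomorphic_zeta_regularized by (simp add: H_def)
  have V_eq: "V = H \<inter> zeta_regularized -` (- {0})" by (auto simp: V_def)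
  have V: "open V"
    unfolding V_eq using holomorphic_on_imp_continuous_on[OF hol] H by (intro continuous_open_preimage) auto
  have VH: "V \<subseteq> H" by (auto simp: V_def)
  have U: "open U"
    unfolding U_def by (intro open_vimage V continuous_intros)
  have sub: "{z. Re z \<ge> 0} \<subseteq> U"
    using zeta_regularized_nonzero by (auto simp: U_def V_def H_def)
  have hols: "q holomorphic_on V" "deriv zeta_regularized holomorphic_on V" "zeta_regularized holomorphic_on V"
      "psi_remainder holomorphic_on V"
    using holomorphic_on_subset[OF pole_lemma_open[OF hol H] VH] holomorphic_on_subset[OF holomorphic_deriv[OF hol H] VH]
      holomorphic_on_subset[OF hol VH] holomorphic_on_subset[OF holomorphic_psi_remainder] VH
    unfolding q_def[abs_def] by (simp_all add: H_def)
  have holF: "F holomorphic_on V"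
    unfolding F_def[abs_def]
    by (intro holomorphic_on_diff holomorphic_on_minus holomorphic_on_divide hols) (simp add: V_def)
  have "F \<circ> (\<lambda>z. 1 + z) holomorphic_on U"
    by (intro holomorphic_on_compose_gen[OF _ holF] holomorphic_intros) (auto simp: U_def)
  then have "(\<lambda>z. F (1 + z)) holomorphic_on U" by (simp add: o_def)
  moreover have "1 + z \<noteq> 0" if "z \<in> U" for z
  proof -
    have "Re (1 + z) > 0" using that by (simp add: U_def V_def H_def)
    then show ?thesis by fastforce
  qed
  ultimately have holg: "g holomorphic_on U"
    unfolding g_def[abs_def] by (intro holomorphic_on_divide holomorphic_intros) auto
  have "g z = (\<Sum>k. of_real (psi_error k) * of_nat k powr (- 2 - z))" if z: "Re z > 0" for z
  proof -
    define w where "w = 1 + z"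
    have w: "Re w > 1" "w \<noteq> 1" "w \<noteq> 0" using z by (auto simp: w_def complex_eq_iff)
    have h: "zeta_regularized w \<noteq> 0" using zeta_regularized_nonzero[of w] w by simp
    have "deriv zeta_regularized w / zeta_regularized w = 1 / (w - 1) - mangoldt_series w"
      using deriv_zeta_regularized[OF w(1)] h by simp
    moreover have "zeta_series w = zeta_regularized w / (w - 1)"
      using zeta_regularized_eq[OF w(1)] w(2) by simp
    ultimately have "F w = mangoldt_series w - zeta_series w - psi_remainder w"
      using w(2) by (simp add: F_def q_def diff_divide_distrib)
    then have "w * (\<Sum>k. of_real (psi_error k) * of_nat k powr (- 2 - z)) = F w"
      using psi_dirichlet_series[OF z] unfolding w_def[symmetric] by simp
    then show ?thesis
      using w(3) unfolding g_def w_def[symmetric] by (metis nonzero_mult_div_cancel_left)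
  qed
  from that[OF U sub holg this] show thesis .
qed

theorem psi_error_series_convergent: "convergent (\<lambda>n. \<Sum>k\<le>n. psi_error k / (real k)\<^sup>2)"
proof -
  obtain U g where g: "open U" "{z. Re z \<ge> 0} \<subseteq> U" "g holomorphic_on U"
    "\<And>z. Re z > 0 \<Longrightarrow> g z = (\<Sum>k. of_real (psi_error k) * of_nat k powr (- 2 - z))"
    by (rule psi_dirichlet_series_continuation[OF that])
  have "(\<lambda>n. psi_partial (Suc n) 0) \<longlonglongrightarrow> g 0"
  proof (rule newman_tauberian[OF g(1-3)])
    show "psi_partial (Suc n) holomorphic_on UNIV" for n
    proof -
      have "(\<lambda>z. of_real (psi_error k) * of_nat k powr (- 2 - z)) holomorphic_on UNIV" for k
        by (cases "k = 0") (auto intro!: holomorphic_intros)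
      then show ?thesis unfolding psi_partial_def[abs_def] by (intro holomorphic_on_sum)
    qed
    show "filterlim (\<lambda>n. ln (real (Suc n))) at_top sequentially"
      by (intro filterlim_compose[OF ln_at_top] filterlim_compose[OF filterlim_real_sequentially filterlim_Suc])
    show "(\<lambda>n. 1 / real (Suc n)) \<longlonglongrightarrow> 0"
      using LIMSEQ_inverse_real_of_nat by (simp add: inverse_eq_divide)
    show "norm (g z - psi_partial (Suc n) z) \<le> 4 * exp (- ln (real (Suc n)) * Re z) / Re z" if "Re z > 0" for n z
      using psi_partial_right(2)[OF that, of n] g(4)[OF that] by simp
    show "norm (psi_partial (Suc n) z) \<le> 4 * exp (- ln (real (Suc n)) * Re z) * (1 / \<bar>Re z\<bar> + 1 / real (Suc n))"
      if "Re z < 0" for n z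
      by (rule psi_partial_left[OF that])
  qed auto
  then have "(\<lambda>n. psi_partial n 0) \<longlonglongrightarrow> g 0"
    by (subst (asm) filterlim_sequentially_Suc)
  then have "(\<lambda>n. Re (psi_partial n 0)) \<longlonglongrightarrow> Re (g 0)" by (rule tendsto_Re)
  moreover have "Re (psi_partial n 0) = (\<Sum>k\<le>n. psi_error k / (real k)\<^sup>2)" for n
  proof -
    have "of_real (psi_error k) * of_nat k powr (- 2 - 0) = complex_of_real (psi_error k / (real k)\<^sup>2)" for k
      by (cases "k = 0") (simp_all add: powr_minus divide_inverse powr_numeral)
    then show ?thesis unfolding psi_partial_def by simp
  qed
  ultimately show ?thesis unfolding convergent_def by auto
qed

section \<open>The prime number theorem\<close>

lemma sum_window:
  fixes f :: "nat \<Rightarrow> real"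
  assumes "m \<le> n"
  shows "sum f {..n} - sum f {..m} = sum f {m<..n}"
proof -
  have "{..n} = {..m} \<union> {m<..n}" using assms by auto
  then show ?thesis by (simp add: sum.union_disjoint ivl_disj_int)
qed

text \<open>
  If \<open>\<psi>(n) > (1 + \<epsilon>) n\<close>, then \<open>\<psi>(k) - k\<close> is at least \<open>\<epsilon> n / 2\<close> for \<open>n < k \<le> n + \<epsilon> n / 2\<close>, because \<open>\<psi>\<close> is increasing.
  The lower bound on \<open>n\<close> makes the rounding of \<open>\<epsilon> n / 2\<close> harmless.
\<close>
lemma psi_window_upper:
  fixes \<epsilon> :: real
  assumes \<epsilon>: "0 < \<epsilon>" "\<epsilon> < 1" and n: "real n \<ge> 4 / \<epsilon>" and big: "chebyshev_psi n > (1 + \<epsilon>) * real n"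
  defines "r \<equiv> nat \<lfloor>\<epsilon> * real n / 2\<rfloor>"
  shows "(\<Sum>k\<in>{n<..n + r}. psi_error k / (real k)\<^sup>2) \<ge> \<epsilon>\<^sup>2 / 32"
proof -
  have n4: "\<epsilon> * real n \<ge> 4" using n \<epsilon> by (simp add: field_simps)
  have npos: "real n > 0" using n4 \<epsilon> by (cases "n = 0") auto
  have r: "real r \<le> \<epsilon> * real n / 2" "real r \<ge> \<epsilon> * real n / 4"
    using n4 unfolding r_def by linarith+
  have "\<epsilon> * real n \<le> real n" using \<epsilon> npos by simp
  have "\<epsilon> / (8 * real n) \<le> psi_error k / (real k)\<^sup>2" if k: "k \<in> {n<..n + r}" for k
  proof -
    have "real k \<le> real n + real r" using k by (simp flip: of_nat_add)
    then have k': "real k \<le> real n + \<epsilon> * real n / 2" "real k \<le> 2 * real n" using r \<open>\<epsilon> * real n \<le> real n\<close> npos by linarith+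
    have "chebyshev_psi k \<ge> chebyshev_psi n" using k by (intro chebyshev_psi_mono) auto
    then have e: "psi_error k \<ge> \<epsilon> * real n / 2" using big k'(1) unfolding psi_error_def by (simp add: algebra_simps)
    have e0: "0 \<le> \<epsilon> * real n / 2" using \<epsilon> by simp
    have "\<epsilon> / (8 * real n) = (\<epsilon> * real n / 2) / (2 * real n)\<^sup>2"
      using npos by (simp add: field_simps power2_eq_square)
    also have "\<dots> \<le> psi_error k / (real k)\<^sup>2"
      using e k'(2) k npos \<epsilon> order_trans[OF e0 e] by (intro frac_le power_mono) auto
    finally show ?thesis .
  qed
  then have "(\<Sum>k\<in>{n<..n + r}. psi_error k / (real k)\<^sup>2) \<ge> (\<Sum>k\<in>{n<..n + r}. \<epsilon> / (8 * real n))"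
    by (rule sum_mono)
  moreover have "(\<Sum>k\<in>{n<..n + r}. \<epsilon> / (8 * real n)) = real r * (\<epsilon> / (8 * real n))" by simp
  moreover have "real r * (\<epsilon> / (8 * real n)) \<ge> (\<epsilon> * real n / 4) * (\<epsilon> / (8 * real n))"
    using r \<epsilon> npos by (intro mult_right_mono) auto
  moreover have "(\<epsilon> * real n / 4) * (\<epsilon> / (8 * real n)) = \<epsilon>\<^sup>2 / 32"
    using npos by (simp add: field_simps power2_eq_square)
  ultimately show ?thesis by linarith
qed

text \<open>
  The same to the left of \<open>n\<close>.  The second conclusion keeps the window within reach of the Cauchy criterion.
\<close>
lemma psi_window_lower:
  fixes \<epsilon> :: real
  assumes \<epsilon>: "0 < \<epsilon>" "\<epsilon> < 1" and n: "real n \<ge> 4 / \<epsilon>" and small: "chebyshev_psi n < (1 - \<epsilon>) * real n"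
  defines "r \<equiv> nat \<lfloor>\<epsilon> * real n / 2\<rfloor>"
  shows "(\<Sum>k\<in>{n - r<..n}. psi_error k / (real k)\<^sup>2) \<le> - (\<epsilon>\<^sup>2 / 32)"
    and "2 * (n - r) \<ge> n"
proof -
  have n4: "\<epsilon> * real n \<ge> 4" using n \<epsilon> by (simp add: field_simps)
  have npos: "real n > 0" using n4 \<epsilon> by (cases "n = 0") auto
  have r: "real r \<le> \<epsilon> * real n / 2" "real r \<ge> \<epsilon> * real n / 4"
    using n4 unfolding r_def by linarith+
  have "\<epsilon> * real n \<le> real n" using \<epsilon> npos by simp
  then have "2 * real r \<le> real n" using r by linarith
  then have rn: "2 * r \<le> n" by linarith
  then show "2 * (n - r) \<ge> n" by simp
  have "psi_error k / (real k)\<^sup>2 \<le> - (\<epsilon> / (2 * real n))" if k: "k \<in> {n - r<..n}" for k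
  proof -
    have k0: "real k > 0" using k by auto
    have "real k \<ge> real n - real r" using k rn by auto
    then have k': "real k \<ge> real n - \<epsilon> * real n / 2" using r by linarith
    have "chebyshev_psi k \<le> chebyshev_psi n" using k by (intro chebyshev_psi_mono) auto
    then have e: "- psi_error k \<ge> \<epsilon> * real n / 2" using small k'(1) unfolding psi_error_def by (simp add: algebra_simps)
    have e0: "0 \<le> \<epsilon> * real n / 2" using \<epsilon> by simp
    have "\<epsilon> / (2 * real n) = (\<epsilon> * real n / 2) / (real n)\<^sup>2"
      using npos by (simp add: field_simps power2_eq_square)
    also have "\<dots> \<le> - psi_error k / (real k)\<^sup>2"
      using e k k0 npos \<epsilon> order_trans[OF e0 e] by (intro frac_le power_mono) auto
    finally show ?thesis by simp
  qed
  then have "(\<Sum>k\<in>{n - r<..n}. psi_error k / (real k)\<^sup>2) \<le> (\<Sum>k\<in>{n - r<..n}. - (\<epsilon> / (2 * real n)))"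
    by (rule sum_mono)
  moreover have "(\<Sum>k\<in>{n - r<..n}. - (\<epsilon> / (2 * real n))) = - (real r * (\<epsilon> / (2 * real n)))" using rn by simp
  moreover have "real r * (\<epsilon> / (2 * real n)) \<ge> (\<epsilon> * real n / 4) * (\<epsilon> / (8 * real n))"
    using r \<epsilon> npos by (intro mult_mono) (auto simp: field_simps)
  moreover have "(\<epsilon> * real n / 4) * (\<epsilon> / (8 * real n)) = \<epsilon>\<^sup>2 / 32"
    using npos by (simp add: field_simps power2_eq_square)
  ultimately show "(\<Sum>k\<in>{n - r<..n}. psi_error k / (real k)\<^sup>2) \<le> - (\<epsilon>\<^sup>2 / 32)" by linarith
qed

theorem prime_number_theorem_psi: "(\<lambda>n. chebyshev_psi n / real n) \<longlonglongrightarrow> 1"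
proof (rule LIMSEQ_I)
  fix e :: real assume "e > 0"
  define \<epsilon> where "\<epsilon> = min (e / 2) (1 / 2)"
  have \<epsilon>: "0 < \<epsilon>" "\<epsilon> < 1" "\<epsilon> < e" using \<open>e > 0\<close> by (auto simp: \<epsilon>_def)
  define s where "s n = (\<Sum>k\<le>n. psi_error k / (real k)\<^sup>2)" for n
  have "Cauchy s"
    using psi_error_series_convergent convergent_Cauchy unfolding s_def by blast
  \<comment> \<open>The threshold is the total mass that a window forced by a deviation of \<open>\<epsilon> n\<close> would carry.\<close>
  then obtain N where N: "\<And>m n. m \<ge> N \<Longrightarrow> n \<ge> N \<Longrightarrow> norm (s m - s n) < \<epsilon>\<^sup>2 / 32"
    using CauchyD[of s "\<epsilon>\<^sup>2 / 32"] \<epsilon> by auto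
  have "norm (chebyshev_psi n / real n - 1) < e" if n: "n \<ge> max (2 * N) (nat \<lceil>4 / \<epsilon>\<rceil>)" for n
  proof -
    have n4: "real n \<ge> 4 / \<epsilon>" and nN: "n \<ge> 2 * N" using n by linarith+
    have npos: "real n > 0" using n4 \<epsilon> by (smt (verit) divide_pos_pos)
    define r where "r = nat \<lfloor>\<epsilon> * real n / 2\<rfloor>"
    have "chebyshev_psi n \<le> (1 + \<epsilon>) * real n"
    proof (rule ccontr)
      assume "\<not> chebyshev_psi n \<le> (1 + \<epsilon>) * real n"
      then have "s (n + r) - s n \<ge> \<epsilon>\<^sup>2 / 32"
        using psi_window_upper[OF \<epsilon>(1,2) n4] unfolding r_def s_def by (subst sum_window) auto
      moreover have "norm (s (n + r) - s n) < \<epsilon>\<^sup>2 / 32" using nN by (intro N) auto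
      ultimately show False unfolding real_norm_def by linarith
    qed
    moreover have "chebyshev_psi n \<ge> (1 - \<epsilon>) * real n"
    proof (rule ccontr)
      assume "\<not> chebyshev_psi n \<ge> (1 - \<epsilon>) * real n"
      then have small: "chebyshev_psi n < (1 - \<epsilon>) * real n" by simp
      have "s n - s (n - r) \<le> - (\<epsilon>\<^sup>2 / 32)"
        using psi_window_lower(1)[OF \<epsilon>(1,2) n4 small] unfolding r_def s_def by (subst sum_window) auto
      moreover have "norm (s n - s (n - r)) < \<epsilon>\<^sup>2 / 32"
        using nN psi_window_lower(2)[OF \<epsilon>(1,2) n4 small] unfolding r_def by (intro N) auto
      ultimately show False unfolding real_norm_def by linarith
    qed
    ultimately have "\<bar>chebyshev_psi n - real n\<bar> \<le> \<epsilon> * real n" by (simp add: abs_le_iff algebra_simps)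
    then have "\<bar>chebyshev_psi n / real n - 1\<bar> \<le> \<epsilon>"
      using npos by (simp add: field_simps abs_le_iff)
    then show ?thesis using \<epsilon>(3) by simp
  qed
  then show "\<exists>no. \<forall>n\<ge>no. norm (chebyshev_psi n / real n - 1) < e" by blast
qed

section \<open>Summation of power asymptotics and removal of logarithmic weights\<close>

lemma Suc_power_difference_bounds:
  "real (Suc k) * real n ^ k \<le> real (Suc n) ^ Suc k - real n ^ Suc k"
  "real (Suc n) ^ Suc k - real n ^ Suc k \<le> real (Suc k) * real (Suc n) ^ k"
proof -
  have "\<exists>z. real n < z \<and> z < real (Suc n) \<and> real (Suc n) ^ Suc k - real n ^ Suc k = (real (Suc n) - real n) * (real (Suc k) * z ^ k)"
  proof (intro MVT2)
    show "((\<lambda>x. x ^ Suc k) has_real_derivative real (Suc k) * x ^ k) (at x)" for x :: real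
      using DERIV_pow[of "Suc k" x] by simp
  qed simp
  then obtain z where z: "real n < z" "z < real (Suc n)" "real (Suc n) ^ Suc k - real n ^ Suc k = real (Suc k) * z ^ k"
    by auto
  show "real (Suc k) * real n ^ k \<le> real (Suc n) ^ Suc k - real n ^ Suc k"
    unfolding z(3) using z(1) by (intro mult_left_mono power_mono) auto
  show "real (Suc n) ^ Suc k - real n ^ Suc k \<le> real (Suc k) * real (Suc n) ^ k"
    unfolding z(3) using z(1,2) by (intro mult_left_mono power_mono) auto
qed

lemma sum_power_bounds:
  "real n ^ Suc k / real (Suc k) \<le> (\<Sum>m\<le>n. real m ^ k)"
  "(\<Sum>m\<le>n. real m ^ k) \<le> real n ^ Suc k / real (Suc k) + real n ^ k"
proof (induction n)
  case (Suc n)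
  have "real n ^ k \<le> (real (Suc n) ^ Suc k - real n ^ Suc k) / real (Suc k)"
    "(real (Suc n) ^ Suc k - real n ^ Suc k) / real (Suc k) \<le> real (Suc n) ^ k"
    using Suc_power_difference_bounds[where k = k and n = n] by (simp_all add: le_divide_eq divide_le_eq mult.commute)
  then show "real (Suc n) ^ Suc k / real (Suc k) \<le> (\<Sum>m\<le>Suc n. real m ^ k)"
    "(\<Sum>m\<le>Suc n. real m ^ k) \<le> real (Suc n) ^ Suc k / real (Suc k) + real (Suc n) ^ k"
    using Suc unfolding sum.atMost_Suc diff_divide_distrib by linarith+
qed auto

lemma sum_power_asymptotic: "(\<lambda>n. (\<Sum>m\<le>n. real m ^ k) / real n ^ Suc k) \<longlonglongrightarrow> 1 / real (Suc k)"
proof (rule tendsto_sandwich)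
  have "\<forall>\<^sub>F n in sequentially. n > (0 :: nat)" by (rule eventually_gt_at_top)
  then show "\<forall>\<^sub>F n in sequentially. 1 / real (Suc k) \<le> (\<Sum>m\<le>n. real m ^ k) / real n ^ Suc k"
  proof eventually_elim
    case (elim n)
    then show ?case using sum_power_bounds(1)[where k = k and n = n] by (simp add: field_simps)
  qed
  have "\<forall>\<^sub>F n in sequentially. n > (0 :: nat)" by (rule eventually_gt_at_top)
  then show "\<forall>\<^sub>F n in sequentially. (\<Sum>m\<le>n. real m ^ k) / real n ^ Suc k \<le> 1 / real (Suc k) + 1 / real n"
  proof eventually_elim
    case (elim n)
    have "(\<Sum>m\<le>n. real m ^ k) / real n ^ Suc k \<le> (real n ^ Suc k / real (Suc k) + real n ^ k) / real n ^ Suc k"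
      using sum_power_bounds(2)[where k = k and n = n] by (intro divide_right_mono) auto
    also have "\<dots> = 1 / real (Suc k) + 1 / real n" using elim by (simp add: add_divide_distrib)
    finally show ?case .
  qed
  have "(\<lambda>n. 1 / real (Suc k) + 1 / real n) \<longlonglongrightarrow> 1 / real (Suc k) + 0"
    by (intro tendsto_intros lim_1_over_n)
  then show "(\<lambda>n. 1 / real (Suc k) + 1 / real n) \<longlonglongrightarrow> 1 / real (Suc k)" by simp
qed simp

lemma sum_null_power:
  fixes v :: "nat \<Rightarrow> real"
  assumes "(\<lambda>m. v m / real m ^ k) \<longlonglongrightarrow> 0"
  shows "(\<lambda>n. (\<Sum>m\<le>n. v m) / real n ^ Suc k) \<longlonglongrightarrow> 0"
proof (rule LIMSEQ_I)
  fix e :: real assume e: "e > 0"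
  obtain M where M: "\<And>m. m \<ge> M \<Longrightarrow> norm (v m / real m ^ k - 0) < e / 4"
    using LIMSEQ_D[OF assms, of "e / 4"] e by auto
  define K where "K = (\<Sum>m\<le>M. \<bar>v m\<bar>)"
  have v: "\<bar>v m\<bar> \<le> (if m \<le> M then \<bar>v m\<bar> else 0) + e / 4 * real m ^ k" for m
  proof (cases "m \<le> M")
    case False
    then have "real m ^ k > 0" "\<bar>v m\<bar> / real m ^ k < e / 4" using M[of m] by (auto simp: abs_divide)
    then show ?thesis using False by (simp add: divide_less_eq)
  qed (use e in auto)
  have bound: "\<bar>\<Sum>m\<le>n. v m\<bar> \<le> K + e / 4 * (\<Sum>m\<le>n. real m ^ k)" for n
  proof -
    have "\<bar>\<Sum>m\<le>n. v m\<bar> \<le> (\<Sum>m\<le>n. (if m \<le> M then \<bar>v m\<bar> else 0) + e / 4 * real m ^ k)"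
      using order_trans[OF sum_abs sum_mono[OF v]] .
    also have "\<dots> = (\<Sum>m\<le>n. if m \<le> M then \<bar>v m\<bar> else 0) + e / 4 * (\<Sum>m\<le>n. real m ^ k)"
      by (simp add: sum.distrib sum_distrib_left)
    also have "(\<Sum>m\<le>n. if m \<le> M then \<bar>v m\<bar> else 0) = (\<Sum>m\<in>{..n} \<inter> {..M}. \<bar>v m\<bar>)"
      by (subst sum.inter_restrict) auto
    also have "\<dots> \<le> K" unfolding K_def by (intro sum_mono2) auto
    finally show ?thesis by simp
  qed
  have "norm ((\<Sum>m\<le>n. v m) / real n ^ Suc k - 0) < e" if n: "n \<ge> max 1 (nat \<lceil>4 * K / e\<rceil> + 1)" for n
  proof -
    have n1: "n \<ge> 1" and nK: "real n > 4 * K / e" using n by linarith+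
    have K0: "K \<ge> 0" by (simp add: K_def sum_nonneg)
    have p: "real n ^ Suc k \<ge> real n" "real n ^ Suc k \<ge> real n ^ k" "real n ^ Suc k > 0"
    proof -
      show "real n ^ Suc k \<ge> real n" using n1 by (intro self_le_power) auto
      show "real n ^ Suc k \<ge> real n ^ k" using n1 by (intro power_increasing) auto
      show "real n ^ Suc k > 0" using n1 by (intro zero_less_power) auto
    qed
    have "(\<Sum>m\<le>n. real m ^ k) \<le> real n ^ Suc k + real n ^ k"
    proof -
      have "real n ^ Suc k / real (Suc k) \<le> real n ^ Suc k" 
        using divide_left_mono[of 1 "real (Suc k)" "real n ^ Suc k"] by simp
      then show ?thesis using sum_power_bounds(2)[where k = k and n = n] by linarith
    qed
    then have "(\<Sum>m\<le>n. real m ^ k) \<le> 2 * real n ^ Suc k" using p by linarith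
    then have "\<bar>\<Sum>m\<le>n. v m\<bar> \<le> K + e / 4 * (2 * real n ^ Suc k)"
      using bound[of n] e by (smt (verit) mult_left_mono divide_pos_pos)
    moreover have "K < e / 4 * real n ^ Suc k"
    proof -
      have "K < e / 4 * real n" using nK e by (simp add: field_simps)
      also have "\<dots> \<le> e / 4 * real n ^ Suc k" using p e by (intro mult_left_mono) auto
      finally show ?thesis .
    qed
    ultimately have "\<bar>\<Sum>m\<le>n. v m\<bar> < e * real n ^ Suc k" using e p(3) by (simp add: algebra_simps)
    then show ?thesis using p(3) by (simp add: abs_divide divide_less_eq)
  qed
  then show "\<exists>no. \<forall>n\<ge>no. norm ((\<Sum>m\<le>n. v m) / real n ^ Suc k - 0) < e" by blast
qed

lemma sum_power_cesaro:
  fixes u :: "nat \<Rightarrow> real"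
  assumes "(\<lambda>m. u m / real m ^ k) \<longlonglongrightarrow> c"
  shows "(\<lambda>n. (\<Sum>m\<le>n. u m) / real n ^ Suc k) \<longlonglongrightarrow> c / real (Suc k)"
proof -
  define v where "v m = u m - c * real m ^ k" for m
  have "(\<lambda>m. u m / real m ^ k - c) \<longlonglongrightarrow> c - c" using assms by (intro tendsto_intros)
  moreover have "\<forall>\<^sub>F m in sequentially. u m / real m ^ k - c = v m / real m ^ k"
    using eventually_gt_at_top[of 0] by eventually_elim (simp add: v_def diff_divide_distrib)
  ultimately have "(\<lambda>m. v m / real m ^ k) \<longlonglongrightarrow> 0" by (simp add: tendsto_cong)
  then have "(\<lambda>n. (\<Sum>m\<le>n. v m) / real n ^ Suc k + c * ((\<Sum>m\<le>n. real m ^ k) / real n ^ Suc k)) \<longlonglongrightarrow> 0 + c * (1 / real (Suc k))"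
    by (intro tendsto_add tendsto_mult sum_null_power sum_power_asymptotic tendsto_const)
  moreover have "(\<Sum>m\<le>n. v m) / real n ^ Suc k + c * ((\<Sum>m\<le>n. real m ^ k) / real n ^ Suc k) = (\<Sum>m\<le>n. u m) / real n ^ Suc k" for n
    by (simp add: v_def sum_subtractf sum_distrib_left diff_divide_distrib)
  ultimately show ?thesis by simp
qed

text \<open>
  All weights \<open>ln m\<close> with \<open>m \<le> n\<close> are at most \<open>ln n\<close>, which gives one direction.  For the other, split at
  \<open>y = n / ln n\<close>: beyond \<open>y\<close> the weight is at least \<open>ln y \<sim> ln n\<close>, and the terms up to \<open>y\<close> contribute about
  \<open>y\<^bsup>k+1\<^esup>\<close>, which is smaller than \<open>n\<^bsup>k+1\<^esup> / ln n\<close> by the factor \<open>(ln n)\<^bsup>k\<^esup>\<close>.  The latter needs \<open>k \<ge> 1\<close>.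
\<close>
lemma sum_without_log:
  fixes a :: "nat \<Rightarrow> real"
  assumes a: "\<And>n. 0 \<le> a n" "\<And>n. a n \<le> real n ^ k" and k: "k \<ge> 1"
    and lim: "(\<lambda>n. (\<Sum>m\<le>n. a m * ln (real m)) / real n ^ Suc k) \<longlonglongrightarrow> c"
  shows "(\<lambda>n. (\<Sum>m\<le>n. a m) * ln (real n) / real n ^ Suc k) \<longlonglongrightarrow> c"
proof (rule tendsto_sandwich)
  define W where "W n = (\<Sum>m\<le>n. a m * ln (real m))" for n
  have a0: "a 0 = 0" using a(1)[of 0] a(2)[of 0] k by (simp add: zero_power)
  have nn: "0 \<le> a m * ln (real m)" for m using a(1)[of m] by (cases "m = 0") auto
  show "(\<lambda>n. W n / real n ^ Suc k) \<longlonglongrightarrow> c" using lim by (simp add: W_def)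
  show "\<forall>\<^sub>F n in sequentially. W n / real n ^ Suc k \<le> (\<Sum>m\<le>n. a m) * ln (real n) / real n ^ Suc k"
  proof (intro always_eventually allI divide_right_mono)
    fix n
    have "a m * ln (real m) \<le> a m * ln (real n)" if "m \<in> {..n}" for m
      using that a(1)[of m] a0 by (cases "m = 0") (auto intro!: mult_left_mono)
    then show "W n \<le> (\<Sum>m\<le>n. a m) * ln (real n)"
      unfolding W_def sum_distrib_right by (rule sum_mono)
  qed simp
  \<comment> \<open>Small enough for the terms below it to be negligible, large enough for \<open>ln y \<sim> ln n\<close>.\<close>
  define y where "y n = real n / ln (real n)" for n
  have "\<forall>\<^sub>F n in sequentially. y n > 1" "\<forall>\<^sub>F n in sequentially. ln (real n) > 1"
    unfolding y_def by real_asymp+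
  then show "\<forall>\<^sub>F n in sequentially. (\<Sum>m\<le>n. a m) * ln (real n) / real n ^ Suc k
      \<le> (1 + ln (real n) / real n) / ln (real n) + W n / real n ^ Suc k * (ln (real n) / ln (y n))"
    using eventually_gt_at_top[of 0]
  proof eventually_elim
    case (elim n)
    define l where "l = ln (real n)"
    have l1: "l > 1" using elim(2) by (simp add: l_def)
    then have l: "l > 1" "l > 0" by simp_all
    have n: "real n > 0" using elim(3) by simp
    have y: "y n > 1" "ln (y n) > 0" "y n = real n / l"
      using elim(1) by (simp_all add: l_def y_def)
    have t: "a m \<le> (if real m \<le> y n then y n ^ k else 0) + a m * ln (real m) / ln (y n)" for m
    proof (cases "real m \<le> y n")
      case True
      have "a m \<le> y n ^ k" using a(2)[of m] power_mono[OF True, of k] by simp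
      moreover have "0 \<le> a m * ln (real m) / ln (y n)" using nn[of m] y(2) by (intro divide_nonneg_pos)
      ultimately show ?thesis using True by simp
    next
      case False
      then have "ln (real m) \<ge> ln (y n)" using y by simp
      then have "a m * ln (y n) \<le> a m * ln (real m)" using a(1) by (intro mult_left_mono)
      then show ?thesis using False y by (simp add: le_divide_eq)
    qed
    have "(\<Sum>m\<le>n. a m) \<le> (\<Sum>m\<le>n. if real m \<le> y n then y n ^ k else 0) + W n / ln (y n)"
      using sum_mono[of "{..n}", OF t] by (simp add: sum.distrib sum_divide_distrib W_def)
    also have "(\<Sum>m\<le>n. if real m \<le> y n then y n ^ k else 0) = real (card {m \<in> {..n}. real m \<le> y n}) * y n ^ k"
      by (simp flip: sum.inter_filter)
    also have "\<dots> \<le> (y n + 1) * y n ^ k"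
    proof (rule mult_right_mono)
      have "card {m \<in> {..n}. real m \<le> y n} \<le> card {..nat \<lfloor>y n\<rfloor>}"
        by (intro card_mono) (auto simp: le_nat_floor)
      also have "\<dots> = nat \<lfloor>y n\<rfloor> + 1" by simp
      finally show "real (card {m \<in> {..n}. real m \<le> y n}) \<le> y n + 1" using y by linarith
    qed (use y in auto)
    finally have "(\<Sum>m\<le>n. a m) * l / real n ^ Suc k \<le> ((y n + 1) * y n ^ k + W n / ln (y n)) * l / real n ^ Suc k"
      using l n by (intro divide_right_mono mult_right_mono) auto
    also have "\<dots> = (y n + 1) * y n ^ k * l / real n ^ Suc k + W n / real n ^ Suc k * (l / ln (y n))"
      by (simp add: add_divide_distrib distrib_right)
    also have "(y n + 1) * y n ^ k * l / real n ^ Suc k = (1 + l / real n) / l ^ k"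
      using l n unfolding y(3) by (simp add: field_simps)
    also have "\<dots> \<le> (1 + l / real n) / l"
      using l n k self_le_power[of l k] by (intro divide_left_mono) auto
    finally show ?case by (simp add: l_def)
  qed
  have "(\<lambda>n. (1 + ln (real n) / real n) / ln (real n)) \<longlonglongrightarrow> 0" by real_asymp
  moreover have "(\<lambda>n. ln (real n) / ln (y n)) \<longlonglongrightarrow> 1" unfolding y_def by real_asymp
  moreover have "(\<lambda>n. W n / real n ^ Suc k) \<longlonglongrightarrow> c" using lim by (simp add: W_def)
  ultimately have "(\<lambda>n. (1 + ln (real n) / real n) / ln (real n) + W n / real n ^ Suc k * (ln (real n) / ln (y n))) \<longlonglongrightarrow> 0 + c * 1"
    by (intro tendsto_add tendsto_mult)
  then show "(\<lambda>n. (1 + ln (real n) / real n) / ln (real n) + W n / real n ^ Suc k * (ln (real n) / ln (y n))) \<longlonglongrightarrow> c"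
    by simp
qed

section \<open>Two-part compositions\<close>

text \<open>
  Summation by parts reduces this to \<open>\<psi>(n) \<sim> n\<close> and to the mean of \<open>\<psi>\<close>.
\<close>
lemma sum_mangoldt_weighted: "(\<lambda>n. (\<Sum>m\<le>n. real m * mangoldt m) / real n ^ 2) \<longlonglongrightarrow> 1 / 2"
proof -
  have abel: "(\<Sum>m\<le>n. real m * mangoldt m) = (real n + 1) * chebyshev_psi n - (\<Sum>m\<le>n. chebyshev_psi m)" for n
    by (induction n) (simp_all add: chebyshev_psi_Suc algebra_simps)
  have 1: "(\<lambda>n. (\<Sum>m\<le>n. chebyshev_psi m) / real n ^ Suc 1) \<longlonglongrightarrow> 1 / real (Suc 1)"
    using prime_number_theorem_psi by (intro sum_power_cesaro) simp
  have "(\<lambda>n. (1 + 1 / real n) * (chebyshev_psi n / real n) - (\<Sum>m\<le>n. chebyshev_psi m) / real n ^ Suc 1) \<longlonglongrightarrow> (1 + 0) * 1 - 1 / real (Suc 1)"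
    by (intro tendsto_intros 1 prime_number_theorem_psi lim_1_over_n)
  moreover have "\<forall>\<^sub>F n in sequentially. (1 + 1 / real n) * (chebyshev_psi n / real n) - (\<Sum>m\<le>n. chebyshev_psi m) / real n ^ Suc 1
      = (\<Sum>m\<le>n. real m * mangoldt m) / real n ^ 2"
    using eventually_gt_at_top[of 0]
  proof eventually_elim
    case (elim n)
    then show ?case unfolding abel by (simp add: field_simps power2_eq_square)
  qed
  ultimately have "(\<lambda>n. (\<Sum>m\<le>n. real m * mangoldt m) / real n ^ 2) \<longlonglongrightarrow> (1 + 0) * 1 - 1 / real (Suc 1)"
    by (rule Lim_transform_eventually)
  then show ?thesis by simp
qed

text \<open>
  A prime power \<open>p ^ k \<le> n\<close> with \<open>k \<ge> 2\<close> has \<open>p \<le> \<surd>n\<close>, and \<open>2 ^ k \<le> n\<close>; so there are few pairs \<open>(p, k)\<close>.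
\<close>
lemma card_proper_primepows_le:
  assumes "n \<ge> 1"
  shows "real (card {m \<in> {..n}. primepow m \<and> \<not> prime m}) \<le> (sqrt (real n) + 1) * (log 2 (real n) + 1)"
proof -
  let ?P = "{..nat \<lfloor>sqrt (real n)\<rfloor>}" and ?K = "{..nat \<lfloor>log 2 (real n)\<rfloor>}"
  have "{m \<in> {..n}. primepow m \<and> \<not> prime m} \<subseteq> (\<lambda>(p, k). p ^ k) ` (?P \<times> ?K)"
  proof
    fix m assume "m \<in> {m \<in> {..n}. primepow m \<and> \<not> prime m}"
    then obtain p k where m: "m \<le> n" "\<not> prime m" "prime p" "k > 0" "m = p ^ k"
      by (auto simp: primepow_def)
    have k2: "k \<ge> 2" using m by (cases "k = 1") auto
    have p2: "p \<ge> 2" using m(3) prime_ge_2_nat by blast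
    have "p ^ 2 \<le> p ^ k" using k2 p2 by (intro power_increasing) auto
    then have "p ^ 2 \<le> n" using m by simp
    then have "real p ^ 2 \<le> real n" by (metis of_nat_le_iff of_nat_power)
    then have "real p \<le> sqrt (real n)" by (rule real_le_rsqrt)
    then have P: "p \<in> ?P" by (simp add: le_nat_floor)
    have "2 ^ k \<le> p ^ k" using p2 by (intro power_mono) auto
    then have "(2 :: nat) ^ k \<le> n" using m(1,5) by linarith
    then have "(2 :: real) ^ k \<le> real n" by (metis of_nat_le_iff of_nat_power of_nat_numeral)
    then have "real k \<le> log 2 (real n)" by (rule le_log_of_power) simp
    then have "k \<in> ?K" by (simp add: le_nat_floor)
    with P m(5) show "m \<in> (\<lambda>(p, k). p ^ k) ` (?P \<times> ?K)" by auto
  qed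
  then have "card {m \<in> {..n}. primepow m \<and> \<not> prime m} \<le> card (?P \<times> ?K)"
    by (rule surj_card_le[rotated]) auto
  also have "\<dots> = (nat \<lfloor>sqrt (real n)\<rfloor> + 1) * (nat \<lfloor>log 2 (real n)\<rfloor> + 1)"
    by (simp add: card_cartesian_product)
  finally have "real (card {m \<in> {..n}. primepow m \<and> \<not> prime m}) \<le> real (nat \<lfloor>sqrt (real n)\<rfloor> + 1) * real (nat \<lfloor>log 2 (real n)\<rfloor> + 1)"
    by (metis of_nat_le_iff of_nat_mult)
  also have "\<dots> \<le> (sqrt (real n) + 1) * (log 2 (real n) + 1)"
  proof (intro mult_mono)
    have "log 2 (real n) \<ge> 0" using assms by (intro zero_le_log_cancel_iff[THEN iffD2]) auto
    then show "real (nat \<lfloor>log 2 (real n)\<rfloor> + 1) \<le> log 2 (real n) + 1" by simp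
    show "real (nat \<lfloor>sqrt (real n)\<rfloor> + 1) \<le> sqrt (real n) + 1" by simp
  qed auto
  finally show ?thesis .
qed

lemma finite_compositions: "finite (compositions n N)"
proof (rule finite_subset)
  show "compositions n N \<subseteq> {l. set l \<subseteq> {..n} \<and> length l = N}"
    by (auto simp: compositions_def member_le_sum_list)
qed (simp add: finite_lists_length_eq)

lemma non_exceeding_count_2:
  "non_exceeding_count n 2 = card {i \<in> {1..<n}. min i (n - i) < smallest_prime_divisor n}"
proof -
  have "{l \<in> compositions n 2. min (l ! 0) (l ! 1) < smallest_prime_divisor (l ! 0 + l ! 1)}
      = (\<lambda>i. [i, n - i]) ` {i \<in> {1..<n}. min i (n - i) < smallest_prime_divisor n}" (is "?L = ?R")
  proof
    show "?L \<subseteq> ?R"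
    proof
      fix l assume l: "l \<in> ?L"
      then obtain i j where ij: "l = [i, j]"
        by (auto simp: compositions_def numeral_2_eq_2 length_Suc_conv)
      then have "i > 0" "j > 0" "i + j = n" "min i j < smallest_prime_divisor n"
        using l by (auto simp: compositions_def)
      then show "l \<in> ?R" using ij by (intro image_eqI[of _ _ i]) auto
    qed
    show "?R \<subseteq> ?L" by (auto simp: compositions_def)
  qed
  then have "non_exceeding_count n 2 = card ?R" by (simp add: non_exceeding_count_def)
  also have "\<dots> = card {i \<in> {1..<n}. min i (n - i) < smallest_prime_divisor n}"
    by (intro card_image) (auto simp: inj_on_def)
  finally show ?thesis .
qed

lemma smallest_prime_divisor_prime:
  assumes "prime p"
  shows "smallest_prime_divisor p = p"
  unfolding smallest_prime_divisor_def
  by (rule Least_equality) (use assms in \<open>auto dest: primes_dvd_imp_eq\<close>)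

lemma smallest_prime_divisor_composite:
  assumes "n \<ge> 2" "\<not> prime n"
  shows "(smallest_prime_divisor n)\<^sup>2 \<le> n"
proof -
  define p where "p = smallest_prime_divisor n"
  have "\<exists>p. prime p \<and> p dvd n" using assms by (intro prime_factor_nat) auto
  then have p: "prime p" "p dvd n"
    unfolding p_def smallest_prime_divisor_def by (metis (mono_tags, lifting) LeastI)+
  then obtain m where m: "n = p * m" by (auto elim: dvdE)
  have "m \<noteq> 1" using assms p m by auto
  then obtain q where q: "prime q" "q dvd m" using prime_factor_nat by blast
  then have "p \<le> q" unfolding p_def smallest_prime_divisor_def
    using m by (intro Least_le) (auto intro: dvd_mult)
  moreover have "q \<le> m" using q(2) m assms by (intro dvd_imp_le) (auto intro: Nat.gr0I)
  ultimately have "p * p \<le> p * m" by (intro mult_left_mono) auto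
  then have "p * p \<le> n" using m by simp
  then show ?thesis unfolding p_def power2_eq_square .
qed

lemma non_exceeding_count_2_prime: "prime p \<Longrightarrow> non_exceeding_count p 2 = p - 1"
proof -
  assume "prime p"
  then have "{i \<in> {1..<p}. min i (p - i) < smallest_prime_divisor p} = {1..<p}"
    by (auto simp: smallest_prime_divisor_prime)
  then show ?thesis by (simp add: non_exceeding_count_2)
qed

lemma non_exceeding_count_2_le: "non_exceeding_count n 2 \<le> n - 1"
proof -
  have "card {i \<in> {1..<n}. min i (n - i) < smallest_prime_divisor n} \<le> card {1..<n}"
    by (intro card_mono) auto
  then show ?thesis by (simp add: non_exceeding_count_2)
qed

text \<open>
  The smaller part determines the composition up to order and lies below the least prime divisor, which
  is at most \<open>\<surd>n\<close>.
\<close>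
lemma non_exceeding_count_2_composite:
  assumes "\<not> prime n"
  shows "real (non_exceeding_count n 2) \<le> 2 * sqrt (real n)"
proof (cases "n \<ge> 2")
  case True
  define p where "p = smallest_prime_divisor n"
  have "{i \<in> {1..<n}. min i (n - i) < p} \<subseteq> {1..<p} \<union> (\<lambda>j. n - j) ` {1..<p}"
  proof
    fix i assume i: "i \<in> {i \<in> {1..<n}. min i (n - i) < p}"
    show "i \<in> {1..<p} \<union> (\<lambda>j. n - j) ` {1..<p}"
    proof (cases "i < p")
      case False
      then have "i = n - (n - i)" "n - i \<in> {1..<p}" using i by auto
      then show ?thesis by blast
    qed (use i in auto)
  qed
  then have "card {i \<in> {1..<n}. min i (n - i) < p} \<le> card ({1..<p} \<union> (\<lambda>j. n - j) ` {1..<p})"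
    by (intro card_mono) auto
  also have "\<dots> \<le> card {1..<p} + card ((\<lambda>j. n - j) ` {1..<p})" by (rule card_Un_le)
  also have "\<dots> \<le> 2 * p" using card_image_le[of "{1..<p}" "\<lambda>j. n - j"] by simp
  finally have "real (non_exceeding_count n 2) \<le> 2 * real p"
    by (simp add: non_exceeding_count_2 p_def)
  moreover have "(real p)\<^sup>2 \<le> real n"
    using smallest_prime_divisor_composite[OF True assms] unfolding p_def by (metis of_nat_le_iff of_nat_power)
  then have "real p \<le> sqrt (real n)" by (rule real_le_rsqrt)
  ultimately show ?thesis by linarith
next
  case False
  then have "non_exceeding_count n 2 = 0" using non_exceeding_count_2_le[of n] by auto
  then show ?thesis by simp
qed

lemma count_mangoldt_difference:
  "\<bar>real (non_exceeding_count m 2) * ln (real m) - real m * mangoldt m\<bar>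
     \<le> 2 * sqrt (real m) * ln (real m) + (if primepow m \<and> \<not> prime m then real m * ln (real m) else 0)"
proof -
  consider "m = 0" | "prime m" | "m \<ge> 1" "\<not> prime m" by fastforce
  then show ?thesis
  proof cases
    case 2
    then have m: "m \<ge> 1" using prime_ge_1_nat by blast
    have "real (non_exceeding_count m 2) * ln (real m) - real m * mangoldt m = - ln (real m)"
      using 2 m by (simp add: non_exceeding_count_2_prime of_nat_diff algebra_simps)
    moreover have "1 * ln (real m) \<le> 2 * sqrt (real m) * ln (real m)"
    proof (rule mult_right_mono)
      have "sqrt (real m) \<ge> 1" using m by simp
      then show "1 \<le> 2 * sqrt (real m)" by linarith
    qed (use m in auto)
    ultimately show ?thesis using 2 m by simp
  next
    case 3
    have "real m * mangoldt m \<le> (if primepow m \<and> \<not> prime m then real m * ln (real m) else 0)"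
      using 3 mangoldt_le_ln[of m] by (auto simp: mangoldt_def intro!: mult_left_mono)
    moreover have "0 \<le> real m * mangoldt m" by (intro mult_nonneg_nonneg mangoldt_nonneg) auto
    moreover have "real (non_exceeding_count m 2) * ln (real m) \<le> 2 * sqrt (real m) * ln (real m)"
      using 3 non_exceeding_count_2_composite by (intro mult_right_mono) auto
    moreover have "0 \<le> real (non_exceeding_count m 2) * ln (real m)" using 3 by simp
    ultimately show ?thesis by linarith
  qed simp
qed

text \<open>
  For a prime \<open>m\<close> the two weights \<open>(m - 1) ln m\<close> and \<open>m \<Lambda>(m)\<close> differ by \<open>ln m\<close> only; composite \<open>m\<close> contribute little
  to the first, and the few higher prime powers contribute little to the second.
\<close>
lemma sum_count_2_log: "(\<lambda>n. (\<Sum>m\<le>n. real (non_exceeding_count m 2) * ln (real m)) / real n ^ 2) \<longlonglongrightarrow> 1 / 2"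
proof -
  define d where "d m = real (non_exceeding_count m 2) * ln (real m) - real m * mangoldt m" for m
  have bound: "\<bar>\<Sum>m\<le>n. d m\<bar> \<le> (real n + 1) * (2 * sqrt (real n) * ln (real n))
      + (sqrt (real n) + 1) * (log 2 (real n) + 1) * (real n * ln (real n))" if n: "n \<ge> 1" for n
  proof -
    have "\<bar>d m\<bar> \<le> 2 * sqrt (real n) * ln (real n) + (if primepow m \<and> \<not> prime m then real n * ln (real n) else 0)"
      if m: "m \<in> {..n}" for m
    proof (cases "m = 0")
      case False
      have "2 * sqrt (real m) * ln (real m) \<le> 2 * sqrt (real n) * ln (real n)"
        using m False by (intro mult_mono) auto
      moreover have "real m * ln (real m) \<le> real n * ln (real n)"
        using m False by (intro mult_mono) auto
      ultimately show ?thesis using count_mangoldt_difference[of m] unfolding d_def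
        by (auto split: if_splits)
    qed (use n in \<open>simp add: d_def\<close>)
    then have "\<bar>\<Sum>m\<le>n. d m\<bar> \<le> (\<Sum>m\<le>n. 2 * sqrt (real n) * ln (real n) + (if primepow m \<and> \<not> prime m then real n * ln (real n) else 0))"
      by (intro order_trans[OF sum_abs sum_mono])
    also have "\<dots> = (real n + 1) * (2 * sqrt (real n) * ln (real n))
        + real (card {m \<in> {..n}. primepow m \<and> \<not> prime m}) * (real n * ln (real n))"
      by (simp add: sum.distrib add.commute flip: sum.inter_filter)
    also have "\<dots> \<le> (real n + 1) * (2 * sqrt (real n) * ln (real n))
        + (sqrt (real n) + 1) * (log 2 (real n) + 1) * (real n * ln (real n))"
      using n by (intro add_left_mono mult_right_mono card_proper_primepows_le) auto
    finally show ?thesis .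
  qed
  have "(\<lambda>n. (\<Sum>m\<le>n. d m) / real n ^ 2) \<longlonglongrightarrow> 0"
  proof (rule Lim_null_comparison)
    show "\<forall>\<^sub>F n in sequentially. norm ((\<Sum>m\<le>n. d m) / real n ^ 2) \<le> ((real n + 1) * (2 * sqrt (real n) * ln (real n))
      + (sqrt (real n) + 1) * (log 2 (real n) + 1) * (real n * ln (real n))) / real n ^ 2"
      using eventually_ge_at_top[of 1]
    proof eventually_elim
      case (elim n)
      then show ?case using bound[OF elim] by (simp add: abs_divide divide_right_mono)
    qed
    show "(\<lambda>n. ((real n + 1) * (2 * sqrt (real n) * ln (real n))
      + (sqrt (real n) + 1) * (log 2 (real n) + 1) * (real n * ln (real n))) / real n ^ 2) \<longlonglongrightarrow> 0"
      unfolding log_def by real_asymp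
  qed
  from tendsto_add[OF this sum_mangoldt_weighted] show ?thesis
    by (simp add: d_def sum_subtractf flip: add_divide_distrib)
qed

section \<open>Longer compositions\<close>

text \<open>
  Deleting the last part: it is not among the first two because \<open>N \<ge> 2\<close>, so the condition is unaffected.
\<close>
lemma non_exceeding_count_Suc:
  assumes N: "N \<ge> 2"
  shows "non_exceeding_count n (Suc N) = (\<Sum>m<n. non_exceeding_count m N)"
proof -
  define P where "P l \<longleftrightarrow> min (l ! 0) (l ! 1) < smallest_prime_divisor (l ! 0 + l ! 1)" for l :: "nat list"
  define S where "S m = {l \<in> compositions m N. P l}" for m
  have P_append: "P (l @ [x]) \<longleftrightarrow> P l" if "length l = N" for l x
    using that N by (simp add: P_def nth_append)
  have "{l \<in> compositions n (Suc N). P l} = (\<Union>m<n. (\<lambda>l. l @ [n - m]) ` S m)" (is "?L = ?R")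
  proof
    show "?L \<subseteq> ?R"
    proof
      fix l assume l: "l \<in> ?L"
      then obtain l' x where l': "l = l' @ [x]"
        by (auto simp: compositions_def length_Suc_conv_rev)
      define m where "m = sum_list l'"
      have x: "x > 0" "m + x = n" "length l' = N" using l l' by (auto simp: compositions_def m_def)
      then have "l' \<in> S m" using l l' P_append[of l' x] by (auto simp: S_def compositions_def m_def)
      moreover have "m < n" "x = n - m" using x by auto
      ultimately show "l \<in> ?R" using l' by blast
    qed
    show "?R \<subseteq> ?L" by (auto simp: S_def compositions_def P_append)
  qed
  then have "non_exceeding_count n (Suc N) = card (\<Union>m<n. (\<lambda>l. l @ [n - m]) ` S m)"
    unfolding non_exceeding_count_def P_def by simp
  also have "\<dots> = (\<Sum>m<n. card ((\<lambda>l. l @ [n - m]) ` S m))"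
  proof (rule card_UN_disjoint)
    show "\<forall>i\<in>{..<n}. finite ((\<lambda>l. l @ [n - i]) ` S i)"
      using finite_compositions by (auto simp: S_def)
  qed auto
  also have "\<dots> = (\<Sum>m<n. card (S m))"
    by (intro sum.cong card_image) (auto simp: inj_on_def)
  finally show ?thesis by (simp add: S_def P_def non_exceeding_count_def)
qed

lemma non_exceeding_count_le:
  assumes "N \<ge> 2"
  shows "real (non_exceeding_count n N) \<le> real n ^ (N - 1)"
  using assms
proof (induction N arbitrary: n rule: dec_induct)
  case base
  then show ?case using non_exceeding_count_2_le[of n] by simp
next
  case (step N)
  have "real (non_exceeding_count n (Suc N)) = (\<Sum>m<n. real (non_exceeding_count m N))"
    using step by (simp add: non_exceeding_count_Suc)
  also have "\<dots> \<le> (\<Sum>m<n. real n ^ (N - 1))"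
    by (intro sum_mono order_trans[OF step.IH] power_mono) auto
  also have "\<dots> = real n ^ (Suc N - 1)" using step(1) by (cases N) auto
  finally show ?case .
qed

definition count_sum :: "nat \<Rightarrow> nat \<Rightarrow> real" where
  "count_sum N n = (\<Sum>m\<le>n. real (non_exceeding_count m N))"

text \<open>
  By the recurrence, the count for \<open>n + 1\<close> and \<open>N + 1\<close> is the summatory function for \<open>N\<close> at \<open>n\<close>; only the shift
  of \<open>n\<close> by \<open>1\<close> in the normalising factors has to be undone.
\<close>
lemma count_asymptotic_step:
  assumes N: "N \<ge> 2" and lim: "(\<lambda>n. count_sum N n * ln (real n) / real n ^ N) \<longlonglongrightarrow> c"
  shows "(\<lambda>n. real (non_exceeding_count n (Suc N)) * ln (real n) / real n ^ N) \<longlonglongrightarrow> c"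
proof -
  have e: "real (non_exceeding_count (Suc n) (Suc N)) = count_sum N n" for n
    using N by (simp add: non_exceeding_count_Suc count_sum_def lessThan_Suc_atMost)
  have "(\<lambda>n. real n / real (Suc n)) \<longlonglongrightarrow> 1" by real_asymp
  from tendsto_power[OF this, of N] have r: "(\<lambda>n. (real n / real (Suc n)) ^ N) \<longlonglongrightarrow> 1" by simp
  have q: "(\<lambda>n. ln (real (Suc n)) / ln (real n)) \<longlonglongrightarrow> 1" by real_asymp
  have "(\<lambda>n. (count_sum N n * ln (real n) / real n ^ N) * (ln (real (Suc n)) / ln (real n)) * (real n / real (Suc n)) ^ N) \<longlonglongrightarrow> c * 1 * 1"
    by (intro tendsto_mult lim r q)
  moreover have "\<forall>\<^sub>F n in sequentially. (count_sum N n * ln (real n) / real n ^ N) * (ln (real (Suc n)) / ln (real n)) * (real n / real (Suc n)) ^ N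
      = real (non_exceeding_count (Suc n) (Suc N)) * ln (real (Suc n)) / real (Suc n) ^ N"
    using eventually_gt_at_top[of 1]
  proof eventually_elim
    case (elim n)
    then have "ln (real n) > 0" by simp
    then show ?case using elim unfolding e by (simp add: power_divide del: of_nat_Suc)
  qed
  ultimately have "(\<lambda>n. real (non_exceeding_count (Suc n) (Suc N)) * ln (real (Suc n)) / real (Suc n) ^ N) \<longlonglongrightarrow> c * 1 * 1"
    by (rule Lim_transform_eventually)
  then show ?thesis by (subst (asm) filterlim_sequentially_Suc) simp
qed

lemma count_sum_asymptotic:
  assumes "N \<ge> 2"
  shows "(\<lambda>n. count_sum N n * ln (real n) / real n ^ N) \<longlonglongrightarrow> 1 / fact N"
  using assms
proof (induction N rule: dec_induct)
  case base
  have "(\<lambda>n. (\<Sum>m\<le>n. real (non_exceeding_count m 2)) * ln (real n) / real n ^ Suc 1) \<longlonglongrightarrow> 1 / 2"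
    using sum_count_2_log non_exceeding_count_le[of 2]
    by (intro sum_without_log) (auto simp: numeral_2_eq_2)
  then show ?case by (simp add: count_sum_def numeral_2_eq_2)
next
  case (step N)
  have "(\<lambda>n. real (non_exceeding_count n (Suc N)) * ln (real n) / real n ^ N) \<longlonglongrightarrow> 1 / fact N"
    using step by (intro count_asymptotic_step)
  from sum_power_cesaro[OF this]
  have "(\<lambda>n. (\<Sum>m\<le>n. real (non_exceeding_count m (Suc N))) * ln (real n) / real n ^ Suc N) \<longlonglongrightarrow> 1 / fact N / real (Suc N)"
    using step non_exceeding_count_le[of "Suc N"] by (intro sum_without_log) auto
  then show ?case by (simp add: count_sum_def mult.commute)
qed

lemma count_sum_real_asymptotic:
  assumes N: "N \<ge> 2"
  shows "(\<lambda>x::real. \<Sum>n | real n \<le> x. real (non_exceeding_count n N)) \<sim>[at_top] (\<lambda>x. 1 / fact N * (x ^ N / ln x))"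
proof (rule asymp_equivI')
  define k where "k x = nat \<lfloor>x\<rfloor>" for x :: real
  have k: "filterlim k at_top at_top" unfolding k_def
    by (rule filterlim_compose[OF filterlim_nat_sequentially filterlim_floor_sequentially])
  have rk: "((\<lambda>x. real (k x) / x) \<longlongrightarrow> 1) at_top" unfolding k_def by real_asymp
  from tendsto_power[OF this, of N] have r: "((\<lambda>x. (real (k x) / x) ^ N) \<longlongrightarrow> 1) at_top" by simp
  have q: "((\<lambda>x. ln x / ln (real (k x))) \<longlongrightarrow> 1) at_top" unfolding k_def by real_asymp
  have "((\<lambda>x. fact N * (count_sum N (k x) * ln (real (k x)) / real (k x) ^ N) * (ln x / ln (real (k x))) * (real (k x) / x) ^ N)
      \<longlongrightarrow> fact N * (1 / fact N) * 1 * 1) at_top"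
    by (intro tendsto_mult r q tendsto_const filterlim_compose[OF count_sum_asymptotic[OF N] k])
  moreover have "\<forall>\<^sub>F x in at_top. fact N * (count_sum N (k x) * ln (real (k x)) / real (k x) ^ N) * (ln x / ln (real (k x))) * (real (k x) / x) ^ N
      = (\<Sum>n | real n \<le> x. real (non_exceeding_count n N)) / (1 / fact N * (x ^ N / ln x))"
    using eventually_gt_at_top[of 2]
  proof eventually_elim
    case (elim x)
    then have "k x \<ge> 2" by (simp add: k_def le_nat_floor)
    then have lk: "ln (real (k x)) > 0" "real (k x) > 0" by auto
    have "{n. real n \<le> x} = {..k x}" using elim by (auto simp: k_def le_nat_floor le_nat_iff le_floor_iff)
    then show ?case using lk elim by (simp add: count_sum_def power_divide field_simps)
  qed
  ultimately show "((\<lambda>x. (\<Sum>n | real n \<le> x. real (non_exceeding_count n N)) / (1 / fact N * (x ^ N / ln x))) \<longlongrightarrow> 1) at_top"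
    by (auto intro: Lim_transform_eventually)
qed

lemma count_asymptotic:
  assumes N: "N \<ge> 3"
  shows "(\<lambda>n::nat. real (non_exceeding_count n N)) \<sim>[at_top] (\<lambda>n. 1 / fact (N - 1) * (real n ^ (N - 1) / ln (real n)))"
proof (rule asymp_equivI')
  define M where "M = N - 1"
  have M: "M \<ge> 2" "N = Suc M" using N by (auto simp: M_def)
  have "(\<lambda>n. fact M * (real (non_exceeding_count n N) * ln (real n) / real n ^ M)) \<longlonglongrightarrow> fact M * (1 / fact M)"
    unfolding M(2) by (intro tendsto_mult tendsto_const count_asymptotic_step count_sum_asymptotic M)
  then show "(\<lambda>n. real (non_exceeding_count n N) / (1 / fact (N - 1) * (real n ^ (N - 1) / ln (real n)))) \<longlonglongrightarrow> 1"
    unfolding M_def[symmetric] by (simp add: mult_ac)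
qed

theorem corollary4p22:
  shows "(\<forall>N::nat. N \<ge> 2 \<longrightarrow>
            (\<lambda>x::real. \<Sum>n | real n \<le> x. real (non_exceeding_count n N))
              \<sim>[at_top] (\<lambda>x. 1 / fact N * (x ^ N / ln x)))
       \<and> (\<forall>N::nat. N \<ge> 3 \<longrightarrow>
            (\<lambda>n::nat. real (non_exceeding_count n N))
              \<sim>[at_top] (\<lambda>n. 1 / fact (N - 1) * (real n ^ (N - 1) / ln (real n))))"
  using count_sum_real_asymptotic count_asymptotic by blast

end
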